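(* Let $k\geqslant 2$ and let $H$ be a $k$-uniform hypergraph on the vertex set $[n]=\{1,\ldots,n\}$ with degree sequence $d_1,\ldots,d_n$. Let $\mathcal{L}_H$ and $\mathcal{Q}_H$ be its Laplacian and signless Laplacian tensors. Then \[ Tr_t(\mathcal{L}_H)=Tr_t(\mathcal{Q}_H)=(k-1)^{n-1}\sum_{i=1}^n d_i^t,\qquad t=1,\ldots,k-1, \] \[ Tr_k(\mathcal{L}_H)=(-1)^k k^{k-1}(k-1)^{n-k}|E(H)|+(k-1)^{n-1}\sum_{i=1}^n d_i^k, \] \[ Tr_k(\mathcal{Q}_H)=k^{k-1}(k-1)^{n-k}|E(H)|+(k-1)^{n-1}\sum_{i=1}^n d_i^k. \]
   Context: A $k$-uniform hypergraph $H$ has a finite vertex set $V(H)$ and an edge set $E(H)$ consisting of $k$-element subsets of $V(H)$; the degree $d_i$ of vertex $i$ is the number of edges containing $i$. The adjacency tensor $\mathcal{A}_H$ is the order $k$, dimension $n=|V(H)|$ tensor with entries $a_{i_1\cdots i_k}=\frac{1}{(k-1)!}$ if $\{i_1,\ldots,i_k\}\in E(H)$ (in particular the indices are distinct) and $a_{i_1\cdots i_k}=0$ otherwise. $\mathcal{D}_H$ is the order $k$ dimension $n$ diagonal tensor whose entry at $(i,i,\ldots,i)$ is $d_i$ and all other entries are $0$. The Laplacian tensor is $\mathcal{L}_H=\mathcal{D}_H-\mathcal{A}_H$ and the signless Laplacian tensor is $\mathcal{Q}_H=\mathcal{D}_H+\mathcal{A}_H$. For an order $k\geqslant2$ dimension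 $n$ tensor $\mathcal{T}=(t_{i_1\cdots i_k})$ and an integer $d\geqslant1$, the $d$-th order trace is \[ Tr_d(\mathcal{T})=(k-1)^{n-1}\sum_{\substack{d_1+\cdots+d_n=d\\ d_i\geqslant 0}}\prod_{i=1}^n\frac{1}{(d_i(k-1))!}\Big(\sum_{y\in[n]^{k-1}}t_{iy}\frac{\partial}{\partial a_{iy}}\Big)^{d_i}\operatorname{tr}(A^{d(k-1)}), \] where $A=(a_{ij})$ is an $n\times n$ matrix of indeterminates, $t_{iy}=t_{ii_2\cdots i_k}$ and $\frac{\partial}{\partial a_{iy}}=\frac{\partial}{\partial a_{ii_2}}\cdots\frac{\partial}{\partial a_{ii_k}}$ for $y=i_2\cdots i_k$. *)

theory Defs
  imports
    Complex_Main
    "HOL-Library.FuncSet"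
    "HOL-Library.Poly_Mapping"
    "Jordan_Normal_Form.Matrix"
begin

definition uniform_hypergraph :: "nat \<Rightarrow> 'v set \<Rightarrow> 'v set set \<Rightarrow> bool" where
  "uniform_hypergraph k V E \<longleftrightarrow> finite V \<and> (\<forall>e\<in>E. e \<subseteq> V \<and> card e = k)"

definition vertex_degree :: "'v set set \<Rightarrow> 'v \<Rightarrow> nat" where
  "vertex_degree E i = card {e \<in> E. i \<in> e}"

text \<open>
  A tensor of order \<open>k\<close> and dimension \<open>n\<close> is a function on index lists; only its values on lists
  of length \<open>k\<close> over \<open>{1..n}\<close> are relevant.
\<close>

type_synonym 'a tensor = "nat list \<Rightarrow> 'a"

text \<open>
  The edges of a \<open>k\<close>-uniform hypergraph have \<open>k\<close> elements, so an index list of length \<open>k\<close> whose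
  set of entries is an edge is automatically distinct.
\<close>

definition adjacency_tensor :: "nat \<Rightarrow> nat set set \<Rightarrow> real tensor" where
  "adjacency_tensor k E = (\<lambda>is. if length is = k \<and> set is \<in> E then 1 / fact (k - 1) else 0)"

definition degree_tensor :: "nat \<Rightarrow> nat set set \<Rightarrow> real tensor" where
  "degree_tensor k E = (\<lambda>is. if is = replicate k (hd is) then real (vertex_degree E (hd is)) else 0)"

definition laplacian_tensor :: "nat \<Rightarrow> nat set set \<Rightarrow> real tensor" where
  "laplacian_tensor k E = (\<lambda>is. degree_tensor k E is - adjacency_tensor k E is)"

definition signless_laplacian_tensor :: "nat \<Rightarrow> nat set set \<Rightarrow> real tensor" where
  "signless_laplacian_tensor k E = (\<lambda>is. degree_tensor k E is + adjacency_tensor k E is)"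

text \<open>
  Polynomials in the indeterminates \<open>a\<^sub>i\<^sub>j\<close>: a monomial maps \<open>(i, j)\<close> to the exponent of \<open>a\<^sub>i\<^sub>j\<close>,
  and a polynomial maps a monomial to its coefficient.
\<close>

type_synonym 'a entry_poly = "((nat \<times> nat) \<Rightarrow>\<^sub>0 nat) \<Rightarrow>\<^sub>0 'a"

definition entry_const :: "'a \<Rightarrow> 'a::comm_ring_1 entry_poly" where
  "entry_const c = Poly_Mapping.single 0 c"

definition entry_var :: "nat \<times> nat \<Rightarrow> 'a::comm_ring_1 entry_poly" where
  "entry_var v = Poly_Mapping.single (Poly_Mapping.single v 1) 1"

text \<open>
  Formal partial derivative. A monomial not containing \<open>v\<close> contributes \<open>0\<close>, so the truncated
  subtraction of exponents is harmless.
\<close>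

definition entry_pderiv :: "nat \<times> nat \<Rightarrow> 'a::comm_ring_1 entry_poly \<Rightarrow> 'a entry_poly" where
  "entry_pderiv v p =
     (\<Sum>m\<in>Poly_Mapping.keys p.
        Poly_Mapping.single (m - Poly_Mapping.single v 1)
          (of_nat (Poly_Mapping.lookup m v) * Poly_Mapping.lookup p m))"

text \<open>Library matrices are indexed from \<open>0\<close>, the indeterminates \<open>a\<^sub>i\<^sub>j\<close> from \<open>1\<close>.\<close>

definition generic_mat :: "nat \<Rightarrow> 'a::comm_ring_1 entry_poly mat" where
  "generic_mat n = mat n n (\<lambda>(i, j). entry_var (Suc i, Suc j))"

definition mat_trace :: "'a::comm_monoid_add mat \<Rightarrow> 'a" where
  "mat_trace M = (\<Sum>i<dim_row M. M $$ (i, i))"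

text \<open>The operator \<open>\<Sum>\<^sub>y t\<^sub>i\<^sub>y \<partial>/\<partial>a\<^sub>i\<^sub>y\<close>, with \<open>y\<close> ranging over the \<open>(k - 1)\<close>-tuples over \<open>{1..n}\<close>.\<close>

definition tensor_diff_op ::
    "nat \<Rightarrow> nat \<Rightarrow> 'a::comm_ring_1 tensor \<Rightarrow> nat \<Rightarrow> 'a entry_poly \<Rightarrow> 'a entry_poly" where
  "tensor_diff_op k n T i p =
     (\<Sum>y\<in>{y. length y = k - 1 \<and> set y \<subseteq> {1..n}}.
        entry_const (T (i # y)) * foldr (\<lambda>j. entry_pderiv (i, j)) y p)"

definition compositions :: "nat \<Rightarrow> nat \<Rightarrow> (nat \<Rightarrow> nat) set" where
  "compositions n d = {c \<in> {1..n} \<rightarrow>\<^sub>E UNIV. (\<Sum>i=1..n. c i) = d}"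

lemma finite_compositions: "finite (compositions n d)"
proof (rule finite_subset)
  show "compositions n d \<subseteq> {1..n} \<rightarrow>\<^sub>E {..d}"
    by (auto simp: compositions_def PiE_iff extensional_def intro: member_le_sum)
qed (auto intro: finite_PiE)

text \<open>
  The product of operators over \<open>i\<close> is their composition; they commute, so its order is
  immaterial. For \<open>c \<in> compositions n d\<close> a differential operator of order \<open>d (k - 1)\<close> is applied
  to a homogeneous polynomial of that degree. The result is thus a constant polynomial, and
  \<open>tensor_trace\<close> reads off its value as the constant coefficient.
\<close>

definition tensor_trace_term ::
    "nat \<Rightarrow> nat \<Rightarrow> nat \<Rightarrow> 'a::field_char_0 tensor \<Rightarrow> (nat \<Rightarrow> nat) \<Rightarrow> 'a entry_poly" where
  "tensor_trace_term k n d T c =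
     foldr (\<lambda>i p. entry_const (1 / fact (c i * (k - 1))) * (tensor_diff_op k n T i ^^ c i) p)
       [1..<Suc n] (mat_trace (generic_mat n ^\<^sub>m (d * (k - 1))))"

definition tensor_trace :: "nat \<Rightarrow> nat \<Rightarrow> nat \<Rightarrow> 'a::field_char_0 tensor \<Rightarrow> 'a" where
  "tensor_trace k n d T =
     of_nat (k - 1) ^ (n - 1) *
     Poly_Mapping.lookup (\<Sum>c\<in>compositions n d. tensor_trace_term k n d T c) 0"

end

theory Submission
  imports Defs "HOL-Combinatorics.Multiset_Permutations"
begin


text \<open>
  Multiplying the coefficient of a monomial by the factorials of its exponents turns differentiation
  into a shift of exponents. The trace thus becomes a weighted sum, over families of \<open>d\<close> stars of
  \<open>k - 1\<close> arcs each, of the number of closed walks that traverse exactly these arcs. A star with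
  non-zero weight consists of loops, or joins a vertex of an edge to the remaining ones. The arcs of
  a closed walk are balanced, so for \<open>d \<le> k\<close> either all stars consist of loops at one vertex, which
  gives the degree powers, or \<open>d = k\<close> and the stars form the complete digraph on an edge. In the
  latter case the BEST theorem and Cayley's formula count the walks.
\<close>

section \<open>Cayley's formula\<close>

text \<open>Both tensors belong to one family with a sign \<open>s\<close> in front of the adjacency
  part. Only edge stars see \<open>s\<close>, and an edge contributes through exactly
  \<open>k\<close> of them; this is the origin of the sign (-1)^k and of the agreement in lower
  degrees. The other constants of an edge come from five counts: (k-1)!^k choices of stars, the
  tensor weight (s/(k-1)!)^k, the normalisation (1/(k-1)!)^k, \<open>k\<close> starting vertices,
  and (k-1)! (k-2)!^(k-1) k^(k-2) Eulerian closed walks from each of them. Since (k-1)! = (k-1)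
  (k-2)!, the product collapses to s^k k^(k-1) / (k-1)^(k-1). Trees and forests are encoded by
  parent functions. Acyclicity is expressed by demanding that no nonempty set of non-roots is mapped
  into itself. This form avoids paths altogether and is easily transferred when roots are peeled off
  or an arc is deleted.\<close>

definition rooted_forests :: "'v set \<Rightarrow> 'v set \<Rightarrow> ('v \<Rightarrow> 'v) set" where
  "rooted_forests V R =
     {f \<in> (V - R) \<rightarrow>\<^sub>E V. \<forall>S. S \<subseteq> V - R \<longrightarrow> S \<noteq> {} \<longrightarrow> (\<exists>x\<in>S. f x \<notin> S)}"

lemma finite_rooted_forests: "finite V \<Longrightarrow> finite (rooted_forests V R)"
  by (rule finite_subset[of _ "(V - R) \<rightarrow>\<^sub>E V"]) (auto simp: rooted_forests_def intro!: finite_PiE)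

text \<open>Peel off the children \<open>P\<close> of the roots; they are the roots of the remaining forest.\<close>

lemma card_rooted_forests_rec:
  assumes "finite V" "R \<subseteq> V"
  shows "card (rooted_forests V R) =
    (\<Sum>P\<in>Pow (V - R). card R ^ card P * card (rooted_forests (V - R) P))"
proof -
  define U where "U = V - R"
  have finU: "finite U" and finR: "finite R"
    using assms by (auto simp: U_def intro: finite_subset)
  \<comment> \<open>A forest is split into the set \<open>P\<close> of children of the roots, an
    arbitrary map from \<open>P\<close> to the roots, and a forest on the non-roots with root set
    \<open>P\<close>.\<close>
  define A where "A = Sigma (Pow U) (\<lambda>P. (P \<rightarrow>\<^sub>E R) \<times> rooted_forests U P)"
  define h where "h f = (let P = {x \<in> U. f x \<in> R} in (P, restrict f P, restrict f (U - P)))"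
    for f :: "'a \<Rightarrow> 'a"
  define g where "g = (\<lambda>(P, f1, f2) x. if x \<in> P then f1 x else (f2 :: 'a \<Rightarrow> 'a) x)"
  have "bij_betw h (rooted_forests V R) A"
  proof (rule bij_betw_byWitness[where f' = g])
    show "\<forall>f\<in>rooted_forests V R. g (h f) = f"
      by (auto simp: g_def h_def Let_def rooted_forests_def U_def PiE_iff extensional_def fun_eq_iff)
    show "\<forall>a\<in>A. h (g a) = a"
    proof safe
      fix P f1 f2 assume a: "(P, f1, f2) \<in> A"
      have P: "P \<subseteq> U" and f1: "f1 \<in> P \<rightarrow>\<^sub>E R" and f2: "f2 \<in> (U - P) \<rightarrow>\<^sub>E U"
        using a by (auto simp: A_def rooted_forests_def)
      have "{x \<in> U. (if x \<in> P then f1 x else f2 x) \<in> R} = P"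
        using P f1 f2 by (auto simp: U_def PiE_iff)
      thus "h (g (P, f1, f2)) = (P, f1, f2)"
        using P f1 f2 by (auto simp: h_def g_def fun_eq_iff PiE_iff extensional_def)
    qed
    show "h ` rooted_forests V R \<subseteq> A"
    proof (rule image_subsetI)
      fix f assume f: "f \<in> rooted_forests V R"
      define P where "P = {x \<in> U. f x \<in> R}"
      have "restrict f (U - P) \<in> rooted_forests U P"
      proof -
        have "\<exists>x\<in>S. restrict f (U - P) x \<notin> S" if "S \<subseteq> U - P" "S \<noteq> {}" for S
        proof -
          obtain x where "x \<in> S" "f x \<notin> S"
            using f \<open>S \<subseteq> U - P\<close> \<open>S \<noteq> {}\<close> unfolding rooted_forests_def U_def by blast
          thus ?thesis using that by (intro bexI[of _ x]) auto
        qed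
        thus ?thesis using f unfolding rooted_forests_def
          by (auto simp: U_def P_def PiE_iff)
      qed
      thus "h f \<in> A" unfolding h_def A_def P_def[symmetric] Let_def
        by (auto simp: P_def)
    qed
    show "g ` A \<subseteq> rooted_forests V R"
    proof (rule image_subsetI, clarify)
      fix P f1 f2 assume a: "(P, f1, f2) \<in> A"
      have P: "P \<subseteq> U" and f1: "f1 \<in> P \<rightarrow>\<^sub>E R" and f2: "f2 \<in> (U - P) \<rightarrow>\<^sub>E U"
        and f2': "\<And>S. S \<subseteq> U - P \<Longrightarrow> S \<noteq> {} \<Longrightarrow> \<exists>x\<in>S. f2 x \<notin> S"
        using a by (auto simp: A_def rooted_forests_def)
      \<comment> \<open>A set meeting \<open>P\<close> is left at once, because \<open>f1\<close>
        leads to a root; a set avoiding \<open>P\<close> is left because \<open>f2\<close> is a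
        forest.\<close>
      have "\<exists>x\<in>S. g (P, f1, f2) x \<notin> S" if S: "S \<subseteq> U" "S \<noteq> {}" for S
      proof (cases "S \<inter> P = {}")
        case True
        hence "S \<subseteq> U - P" using S by auto
        then obtain x where "x \<in> S" "f2 x \<notin> S" using f2' S by blast
        thus ?thesis using True by (intro bexI[of _ x]) (auto simp: g_def)
      next
        case False
        then obtain x where "x \<in> S" "x \<in> P" by blast
        thus ?thesis using f1 S by (intro bexI[of _ x]) (auto simp: g_def U_def PiE_iff)
      qed
      moreover have "g (P, f1, f2) \<in> U \<rightarrow>\<^sub>E V"
        using P f1 f2 assms by (auto simp: g_def U_def PiE_iff extensional_def)
      ultimately show "g (P, f1, f2) \<in> rooted_forests V R"
        by (auto simp: rooted_forests_def U_def)
    qed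
  qed
  hence "card (rooted_forests V R) = card A" by (rule bij_betw_same_card)
  also have "\<dots> = (\<Sum>P\<in>Pow U. card ((P \<rightarrow>\<^sub>E R) \<times> rooted_forests U P))"
    unfolding A_def using finU finR
    by (intro card_SigmaI) (auto intro!: finite_PiE finite_rooted_forests dest: finite_subset)
  also have "\<dots> = (\<Sum>P\<in>Pow U. card R ^ card P * card (rooted_forests U P))"
    using finU by (intro sum.cong) (auto simp: card_cartesian_product card_PiE dest: finite_subset)
  finally show ?thesis by (simp add: U_def)
qed

lemma sum_Pow_card:
  fixes g :: "nat \<Rightarrow> 'b::comm_semiring_1"
  assumes "finite U"
  shows "(\<Sum>P\<in>Pow U. g (card P)) = (\<Sum>p\<le>card U. of_nat (card U choose p) * g p)"
proof -
  have "(\<Sum>P\<in>Pow U. g (card P)) = (\<Sum>p\<le>card U. \<Sum>P\<in>{P \<in> Pow U. card P = p}. g (card P))"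
    using assms by (intro sum.group[symmetric]) (auto intro: card_mono)
  also have "\<dots> = (\<Sum>p\<le>card U. of_nat (card U choose p) * g p)"
    by (intro sum.cong refl) (simp add: n_subsets[OF assms])
  finally show ?thesis .
qed

text \<open>This is the binomial theorem differentiated in \<open>a\<close> and multiplied by
  \<open>a\<close>. The absorption identity p * C(m+1, p) = (m+1) * C(m, p-1) takes the place of the
  derivative.\<close>

lemma sum_binomial_weighted:
  fixes a b :: nat
  shows "(\<Sum>p\<le>Suc m. (Suc m choose p) * (p * a ^ p * b ^ (Suc m - p))) = Suc m * a * (a + b) ^ m"
proof -
  have "(\<Sum>p\<le>Suc m. (Suc m choose p) * (p * a ^ p * b ^ (Suc m - p))) =
        (\<Sum>p\<le>m. (Suc m choose Suc p) * (Suc p * a ^ Suc p * b ^ (m - p)))"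
    by (subst sum.atMost_Suc_shift) simp
  also have "\<dots> = (\<Sum>p\<le>m. Suc m * a * ((m choose p) * a ^ p * b ^ (m - p)))"
  proof (intro sum.cong refl)
    fix p
    have "(Suc m choose Suc p) * (Suc p * a ^ Suc p * b ^ (m - p)) =
          (Suc p * (Suc m choose Suc p)) * a ^ Suc p * b ^ (m - p)" by (simp only: mult_ac)
    also have "\<dots> = Suc m * a * ((m choose p) * a ^ p * b ^ (m - p))"
      unfolding Suc_times_binomial by (simp only: power_Suc mult_ac)
    finally show "(Suc m choose Suc p) * (Suc p * a ^ Suc p * b ^ (m - p)) =
      Suc m * a * ((m choose p) * a ^ p * b ^ (m - p))" .
  qed
  also have "\<dots> = Suc m * a * (a + b) ^ m"
    by (simp add: binomial sum_distrib_left)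
  finally show ?thesis .
qed

text \<open>The familiar count r n^(n-r-1) is multiplied by n here: for \<open>R = V\<close> its
  exponent would be -1, which truncated subtraction turns into a wrong value.\<close>

lemma card_rooted_forests:
  assumes "finite V" "R \<subseteq> V"
  shows "card (rooted_forests V R) * card V = card R * card V ^ (card V - card R)"
  using assms
proof (induction "card V" arbitrary: V R rule: less_induct)
  case less
  have finR: "finite R" using less.prems by (rule rev_finite_subset)
  show ?case
  proof (cases "R = {} \<or> R = V")
    case True
    have "rooted_forests V {} = {}" if "V \<noteq> {}" using that
      by (auto simp: rooted_forests_def PiE_iff)
    moreover have "rooted_forests V V = {\<lambda>x. undefined}" by (auto simp: rooted_forests_def)
    ultimately show ?thesis using True by (cases "V = {}") auto
  next
    case False
    define U where "U = V - R"
    define r where "r = card R"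
    have finU: "finite U" using less.prems by (auto simp: U_def)
    have "U \<noteq> {}" using False less.prems by (auto simp: U_def)
    then obtain m where m: "card U = Suc m" using finU
      by (cases "card U") auto
    have n: "card V = r + Suc m"
      using less.prems finR m card_Diff_subset[of R V] card_mono[of V R]
      by (simp add: U_def r_def)
    have "r > 0" using False finR by (auto simp: r_def card_gt_0_iff)
    \<comment> \<open>The factor \<open>Suc m = card U\<close> gives every summand the shape of the
      induction hypothesis. The weighted binomial sum returns the same factor, which is then
      cancelled.\<close>
    have "card (rooted_forests V R) * Suc m =
        (\<Sum>P\<in>Pow U. r ^ card P * (card (rooted_forests U P) * card U))"
      unfolding card_rooted_forests_rec[OF less.prems] U_def[symmetric] r_def[symmetric] m
      by (simp only: sum_distrib_right mult.assoc)
    also have "\<dots> = (\<Sum>P\<in>Pow U. r ^ card P * (card P * card U ^ (card U - card P)))"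
      using less.hyps[of U] n m finU \<open>r > 0\<close> by (intro sum.cong) auto
    also have "\<dots> = (\<Sum>P\<in>Pow U. card P * r ^ card P * Suc m ^ (Suc m - card P))"
      by (simp only: m mult_ac)
    also have "\<dots> = Suc m * r * (r + Suc m) ^ m"
      using sum_Pow_card[OF finU, of "\<lambda>p. p * r ^ p * Suc m ^ (Suc m - p)"]
        sum_binomial_weighted[of m r "Suc m"] by (simp only: m of_nat_id)
    finally have "card (rooted_forests V R) = r * (r + Suc m) ^ m" 
      by (metis mult.assoc mult.commute mult_cancel1 nat.distinct(1))
    thus ?thesis by (simp add: n r_def[symmetric] mult_ac)
  qed
qed


section \<open>Eulerian walks\<close>

text \<open>This counts the walks using every arc of \<open>M\<close> exactly once only if \<open>card M = L\<close>.\<close>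

fun euler_walks :: "nat \<Rightarrow> 'v \<Rightarrow> 'v \<Rightarrow> ('v \<times> 'v) set \<Rightarrow> nat" where
  "euler_walks 0 u r M = (if u = r then 1 else 0)"
| "euler_walks (Suc L) u r M = (\<Sum>w\<in>M `` {u}. euler_walks L w r (M - {(u, w)}))"

text \<open>These are the spanning trees directed towards \<open>r\<close>. Only vertices with an
  outgoing arc choose a parent; under the balance condition of the BEST theorem every vertex other
  than \<open>r\<close> that is entered is also left, so following parents ends at
  \<open>r\<close>.\<close>

definition arborescences :: "('v \<times> 'v) set \<Rightarrow> 'v \<Rightarrow> ('v \<Rightarrow> 'v) set" where
  "arborescences M r =
     {f \<in> Pi\<^sub>E (Domain M - {r}) (\<lambda>x. M `` {x}).
        \<forall>S. S \<subseteq> Domain M - {r} \<longrightarrow> S \<noteq> {} \<longrightarrow> (\<exists>x\<in>S. f x \<notin> S)}"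

lemma finite_Image_of_finite: "finite M \<Longrightarrow> finite (M `` A)"
  by (rule finite_subset[of _ "snd ` M"]) force+

lemma finite_arborescences: "finite M \<Longrightarrow> finite (arborescences M r)"
  by (rule finite_subset[of _ "Pi\<^sub>E (Domain M - {r}) (\<lambda>x. M `` {x})"])
     (auto simp: arborescences_def finite_Domain intro!: finite_PiE finite_Image_of_finite)

text \<open>Acyclicity applied to the whole domain yields a parent outside the domain, hence a
  vertex that is entered but never left. This covers arc sets that do not touch the root, where no
  Eulerian walk from \<open>r\<close> exists.\<close>

lemma arborescences_empty_if_no_arc_at_root:
  assumes "M \<noteq> {}" "M `` {r} = {}" "M\<inverse> `` {r} = {}"
    and "\<And>x. x \<noteq> r \<Longrightarrow> M\<inverse> `` {x} \<noteq> {} \<Longrightarrow> M `` {x} \<noteq> {}"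
  shows "arborescences M r = {}"
proof (rule ccontr)
  assume "arborescences M r \<noteq> {}"
  then obtain f where f: "f \<in> arborescences M r" by blast
  have D: "Domain M - {r} = Domain M" using assms(2) by auto
  have "Domain M \<noteq> {}" using assms(1) by auto
  then obtain x where x: "x \<in> Domain M" "f x \<notin> Domain M"
    using f unfolding arborescences_def D by blast
  have fx: "(x, f x) \<in> M" using f x(1) unfolding arborescences_def D by (auto simp: PiE_iff)
  hence "f x \<noteq> r" using assms(3) by auto
  hence "M `` {f x} \<noteq> {}" using assms(4)[of "f x"] fx by auto
  thus False using x(2) by auto
qed

text \<open>At \<open>u\<close> there is no choice of parent, and no vertex can choose
  \<open>u\<close> as its parent, so \<open>u\<close> lies on no cycle and can be removed from the
  domain.\<close>

lemma card_arborescences_pendant: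
  assumes "u \<noteq> r" "M `` {u} = {w}" "M\<inverse> `` {u} = {}"
  shows "card (arborescences M r) = card (arborescences (M - {(u, w)}) r)"
proof -
  define M' where "M' = M - {(u, w)}"
  define D where "D = Domain M - {r}"
  have D': "Domain M' - {r} = D - {u}" using assms by (auto simp: M'_def D_def)
  have uD: "u \<in> D" using assms by (auto simp: D_def)
  have out: "M' `` {x} = M `` {x}" if "x \<noteq> u" for x using that by (auto simp: M'_def)
  have nu: "(x, u) \<notin> M" for x using assms(3) by auto
  have uw: "(u, w) \<in> M" "w \<noteq> u" using assms(2) nu by auto
  have "bij_betw (\<lambda>f. restrict f (D - {u})) (arborescences M r) (arborescences M' r)"
  proof (rule bij_betw_byWitness[where f' = "\<lambda>g. g(u := w)"])
    show "\<forall>f\<in>arborescences M r. (restrict f (D - {u}))(u := w) = f"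
    proof
      fix f assume "f \<in> arborescences M r"
      hence f: "f \<in> Pi\<^sub>E D (\<lambda>x. M `` {x})" by (auto simp: arborescences_def D_def)
      hence "f u = w" using uD assms(2) by auto
      thus "(restrict f (D - {u}))(u := w) = f"
        using f by (auto simp: fun_eq_iff PiE_iff extensional_def)
    qed
    show "\<forall>g\<in>arborescences M' r. restrict (g(u := w)) (D - {u}) = g"
      unfolding arborescences_def D' by (auto simp: fun_eq_iff PiE_iff extensional_def)
    show "(\<lambda>f. restrict f (D - {u})) ` arborescences M r \<subseteq> arborescences M' r"
    proof (rule image_subsetI)
      fix f assume f: "f \<in> arborescences M r"
      have "\<exists>x\<in>S. restrict f (D - {u}) x \<notin> S" if S: "S \<subseteq> D - {u}" "S \<noteq> {}" for S
      proof -
        have "S \<subseteq> Domain M - {r}" using S by (auto simp: D_def)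
        then obtain x where "x \<in> S" "f x \<notin> S" using f S(2) unfolding arborescences_def by blast
        thus ?thesis using S by (intro bexI[of _ x]) auto
      qed
      thus "restrict f (D - {u}) \<in> arborescences M' r"
        using f out unfolding arborescences_def D' by (auto simp: D_def PiE_iff)
    qed
    show "(\<lambda>g. g(u := w)) ` arborescences M' r \<subseteq> arborescences M r"
    proof (rule image_subsetI)
      fix g assume g: "g \<in> arborescences M' r"
      have g1: "g \<in> Pi\<^sub>E (D - {u}) (\<lambda>x. M' `` {x})"
        and g2: "\<And>S. S \<subseteq> D - {u} \<Longrightarrow> S \<noteq> {} \<Longrightarrow> \<exists>x\<in>S. g x \<notin> S"
        using g unfolding arborescences_def D' by auto
      have "\<exists>x\<in>S. (g(u := w)) x \<notin> S" if S: "S \<subseteq> D" "S \<noteq> {}" for S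
      proof (cases "S = {u}")
        case True
        thus ?thesis using uw by auto
      next
        case False
        hence "S - {u} \<subseteq> D - {u}" "S - {u} \<noteq> {}" using S by auto
        then obtain x where x: "x \<in> S - {u}" "g x \<notin> S - {u}" using g2 by blast
        hence "(x, g x) \<in> M'" using g1 S by (auto simp: PiE_iff)
        hence "g x \<noteq> u" using nu by (auto simp: M'_def)
        thus ?thesis using x by (intro bexI[of _ x]) auto
      qed
      moreover have "g(u := w) \<in> Pi\<^sub>E D (\<lambda>x. M `` {x})"
        using g1 uw uD by (auto simp: PiE_iff extensional_def M'_def)
      ultimately show "g(u := w) \<in> arborescences M r"
        by (auto simp: arborescences_def D_def)
    qed
  qed
  thus ?thesis unfolding M'_def by (rule bij_betw_same_card)
qed

text \<open>The second arc leaving \<open>u\<close> keeps \<open>u\<close> in the domain, so the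
  deletion only forbids one choice of parent.\<close>

lemma arborescences_delete_arc:
  assumes "w' \<in> M `` {u}" "w' \<noteq> w" "u \<noteq> r"
  shows "arborescences (M - {(u, w)}) r = {f \<in> arborescences M r. f u \<noteq> w}"
proof -
  have D: "Domain (M - {(u, w)}) = Domain M" using assms by auto
  have "u \<in> Domain M - {r}" using assms by auto
  thus ?thesis unfolding arborescences_def D
    by (auto simp: PiE_iff)
qed

text \<open>Double counting: a tree survives the deletion of every arc at \<open>u\<close> except
  the one it uses there.\<close>

lemma sum_card_arborescences_delete_arc:
  assumes "finite M" "card (M `` {u}) \<ge> 2" "u \<noteq> r"
  shows "(\<Sum>w\<in>M `` {u}. card (arborescences (M - {(u, w)}) r)) =
    (card (M `` {u}) - 1) * card (arborescences M r)"
proof -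
  define B where "B = M `` {u}"
  have finB: "finite B" using assms(1) by (simp add: B_def finite_Image_of_finite)
  have ex: "\<exists>w'\<in>B. w' \<noteq> w" for w
  proof (rule ccontr)
    assume "\<not> ?thesis"
    hence "B \<subseteq> {w}" by auto
    hence "card B \<le> 1" using card_mono[of "{w}" B] by simp
    thus False using assms(2) by (simp add: B_def)
  qed
  have "(\<Sum>w\<in>B. card (arborescences (M - {(u, w)}) r)) =
        (\<Sum>w\<in>B. card {f \<in> arborescences M r. f u \<noteq> w})"
  proof (intro sum.cong refl)
    fix w
    obtain w' where "w' \<in> B" "w' \<noteq> w" using ex by blast
    thus "card (arborescences (M - {(u, w)}) r) = card {f \<in> arborescences M r. f u \<noteq> w}"
      using arborescences_delete_arc[of w' M u w r] assms(3) by (simp add: B_def)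
  qed
  also have "\<dots> = (\<Sum>w\<in>B. \<Sum>f\<in>arborescences M r. of_bool (f u \<noteq> w))"
    using finite_arborescences[OF assms(1), of r] by (simp add: Int_def)
  also have "\<dots> = (\<Sum>f\<in>arborescences M r. \<Sum>w\<in>B. of_bool (f u \<noteq> w))"
    by (rule sum.swap)
  also have "\<dots> = (\<Sum>f\<in>arborescences M r. card B - 1)"
  proof (intro sum.cong refl)
    fix f assume "f \<in> arborescences M r"
    moreover have "u \<in> Domain M - {r}" using ex assms(3) by (auto simp: B_def)
    ultimately have fu: "f u \<in> B" by (auto simp: arborescences_def B_def PiE_iff)
    have "(\<Sum>w\<in>B. of_bool (f u \<noteq> w)) = card (B - {f u})"
      using finB by (simp add: Int_def) (auto intro!: arg_cong[where f = card])
    thus "(\<Sum>w\<in>B. of_bool (f u \<noteq> w)) = card B - 1" using fu finB by simp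
  qed
  finally show ?thesis by (simp add: B_def mult.commute)
qed

text \<open>
  The BEST theorem for simple digraphs, in a form for open walks that can be proved by deleting the
  first arc.
\<close>

theorem euler_walks_eq:
  assumes "finite M" "card M = L"
    and "\<And>x. card (M `` {x}) + of_bool (x = r) = card (M\<inverse> `` {x}) + of_bool (x = u)"
  shows "euler_walks L u r M =
    fact (card (M `` {r})) * (\<Prod>x\<in>Domain M - {r}. fact (card (M `` {x}) - 1)) *
    card (arborescences M r)"
  using assms
proof (induction L arbitrary: u M)
  case 0
  hence M: "M = {}" by simp
  have "u = r" using "0.prems"(3)[of r] M by (cases "u = r") auto
  thus ?case by (simp add: M arborescences_def)
next
  case (Suc L)
  define D where "D = Domain M - {r}"
  define B where "B = M `` {u}"
  have finD: "finite D" and finB: "finite B" and fin_in: "\<And>x. finite (M\<inverse> `` {x})"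
    and fin_out: "\<And>x. finite (M `` {x})"
    using Suc.prems(1) by (auto simp: D_def B_def finite_Domain finite_Image_of_finite)
  have IH: "euler_walks L w r (M - {(u, w)}) =
      fact (card ((M - {(u, w)}) `` {r})) *
      (\<Prod>x\<in>Domain (M - {(u, w)}) - {r}. fact (card ((M - {(u, w)}) `` {x}) - 1)) *
      card (arborescences (M - {(u, w)}) r)" if w: "w \<in> B" for w
  proof (rule Suc.IH)
    have uw: "(u, w) \<in> M" using w by (simp add: B_def)
    show "finite (M - {(u, w)})" "card (M - {(u, w)}) = L" using Suc.prems uw by auto
    fix x
    have "(M - {(u, w)}) `` {x} = (if x = u then M `` {x} - {w} else M `` {x})" by auto
    hence 1: "card (M `` {x}) = card ((M - {(u, w)}) `` {x}) + of_bool (x = u)"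
      using uw fin_out[of u] card_Suc_Diff1[of "M `` {u}" w] by auto
    have "(M - {(u, w)})\<inverse> `` {x} = (if x = w then M\<inverse> `` {x} - {u} else M\<inverse> `` {x})" by auto
    hence 2: "card (M\<inverse> `` {x}) = card ((M - {(u, w)})\<inverse> `` {x}) + of_bool (x = w)"
      using uw fin_in[of w] card_Suc_Diff1[of "M\<inverse> `` {w}" u] by auto
    show "card ((M - {(u, w)}) `` {x}) + of_bool (x = r) =
          card ((M - {(u, w)})\<inverse> `` {x}) + of_bool (x = w)"
      using Suc.prems(3)[of x] 1 2 by linarith
  qed
  have out_other: "(M - {(u, w)}) `` {x} = M `` {x}" if "x \<noteq> u" for x w using that by auto
  have out_u: "card ((M - {(u, w)}) `` {u}) = card B - 1" if "w \<in> B" for w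
  proof -
    have "(M - {(u, w)}) `` {u} = B - {w}" by (auto simp: B_def)
    thus ?thesis using that finB by simp
  qed
  show ?case
  proof (cases "u = r")
    case True
    \<comment> \<open>Trees use no arc leaving the root, so every first arc leaves the same tree
      count. At \<open>r\<close> no arc is reserved for a tree, hence the full factorial of the
      out-degree.\<close>
    define C where "C = (\<Prod>x\<in>D. fact (card (M `` {x}) - 1)) * card (arborescences M r)"
    have dom: "Domain (M - {(u, w)}) - {r} = D" for w using True by (auto simp: D_def)
    have "arborescences (M - {(u, w)}) r = arborescences M r" for w
    proof -
      have "Pi\<^sub>E D (\<lambda>x. (M - {(u, w)}) `` {x}) = Pi\<^sub>E D (\<lambda>x. M `` {x})"
        using True by (intro PiE_cong out_other) (auto simp: D_def)
      thus ?thesis unfolding arborescences_def dom by (simp add: D_def)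
    qed
    moreover have "(\<Prod>x\<in>D. fact (card ((M - {(u, w)}) `` {x}) - 1)) =
        (\<Prod>x\<in>D. fact (card (M `` {x}) - 1) :: nat)" for w
      using True out_other by (intro prod.cong) (auto simp: D_def)
    ultimately have "euler_walks L w r (M - {(u, w)}) = fact (card B - 1) * C" if "w \<in> B" for w
      unfolding IH[OF that] dom using out_u[OF that] True by (simp add: C_def mult.assoc)
    hence "euler_walks (Suc L) u r M = (\<Sum>w\<in>B. fact (card B - 1) * C)"
      by (simp add: B_def)
    also have "\<dots> = card B * (fact (card B - 1) * C)" by simp
    also have "\<dots> = fact (card B) * C"
    proof (cases "card B = 0")
      \<comment> \<open>No walk can start here, so the tree count on the right must vanish although
        the factorial is 1.\<close>
      case True': True
      hence "B = {}" using finB by simp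
      moreover have "M \<noteq> {}" using Suc.prems by auto
      moreover have bal: "M `` {x} = {} \<longleftrightarrow> M\<inverse> `` {x} = {}" for x
      proof -
        have "card (M `` {x}) = card (M\<inverse> `` {x})" using Suc.prems(3)[of x] True by simp
        thus ?thesis by (simp only: card_0_eq[OF fin_in, symmetric] card_0_eq[OF fin_out, symmetric])
      qed
      ultimately have "arborescences M r = {}"
        using bal[of r] True unfolding B_def
        by (intro arborescences_empty_if_no_arc_at_root) (simp_all only: bal simp_thms)
      thus ?thesis using True' by (simp add: C_def)
    next
      case False
      thus ?thesis using fact_reduce[of "card B", where ?'a = nat] by simp
    qed
    finally show ?thesis using True by (simp add: B_def C_def D_def mult.assoc)
  next
    case False
    have out: "card B = Suc (card (M\<inverse> `` {u}))"
      using Suc.prems(3)[of u] False by (simp add: B_def)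
    have uD: "u \<in> D" using out False by (cases "B = {}") (auto simp: B_def D_def)
    define P where "P = fact (card (M `` {r})) * (\<Prod>x\<in>D - {u}. fact (card (M `` {x}) - 1) :: nat)"
    have rhs: "fact (card (M `` {r})) * (\<Prod>x\<in>D. fact (card (M `` {x}) - 1)) = P * fact (card B - 1)"
      unfolding P_def using prod.remove[OF finD uD, of "\<lambda>x. fact (card (M `` {x}) - 1) :: nat"]
      by (simp add: B_def mult_ac)
    show ?thesis
    proof (cases "card B = 1")
      case True
      then obtain w where w: "B = {w}" by (auto simp: card_1_singleton_iff)
      \<comment> \<open>By balance no arc enters \<open>u\<close> when its last outgoing arc is
        taken, so \<open>u\<close> disappears from the remaining digraph.\<close>
      have inu: "M\<inverse> `` {u} = {}" using out True fin_in[of u] by simp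
      have dom: "Domain (M - {(u, w)}) - {r} = D - {u}"
        using w inu by (auto simp: B_def D_def)
      have wB: "w \<in> B" using w by simp
      have "euler_walks (Suc L) u r M = euler_walks L w r (M - {(u, w)})"
        using w by (simp add: B_def)
      also have "\<dots> = P * card (arborescences M r)"
        using IH[OF wB] w out_other False card_arborescences_pendant[OF False _ inu, of w]
        by (simp add: dom P_def B_def)
      finally show ?thesis using rhs True by (simp add: D_def)
    next
      case False': False
      hence two: "card B \<ge> 2" using out by linarith
      have "euler_walks L w r (M - {(u, w)}) =
          P * fact (card B - 2) * card (arborescences (M - {(u, w)}) r)" if w: "w \<in> B" for w
      proof -
        have "B - {w} \<noteq> {}"
        proof
          assume "B - {w} = {}"
          hence "B = {w}" using w by auto
          thus False using False' by simp
        qed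
        then obtain w' where w': "w' \<in> B" "w' \<noteq> w" by blast
        hence dom: "Domain (M - {(u, w)}) - {r} = D" by (auto simp: D_def B_def)
        have "(\<Prod>x\<in>D. fact (card ((M - {(u, w)}) `` {x}) - 1)) =
              (fact (card B - 2) * (\<Prod>x\<in>D - {u}. fact (card (M `` {x}) - 1)) :: nat)"
          using out_u[OF w] out_other
          by (simp add: prod.remove[OF finD uD] numeral_2_eq_2)
        thus ?thesis using IH[OF w] out_other False by (simp add: dom P_def mult_ac)
      qed
      hence "euler_walks (Suc L) u r M =
          P * fact (card B - 2) * (\<Sum>w\<in>B. card (arborescences (M - {(u, w)}) r))"
        by (simp add: B_def sum_distrib_left)
      \<comment> \<open>Each first arc lowers the factorial at \<open>u\<close> by one step; the
        double count of trees supplies the missing factor \<open>card B - 1\<close>.\<close>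
      also have "\<dots> = P * (fact (card B - 2) * (card B - 1)) * card (arborescences M r)"
        using sum_card_arborescences_delete_arc[OF Suc.prems(1) _ False] two
        by (simp add: B_def)
      also have "fact (card B - 2) * (card B - 1) = (fact (card B - 1) :: nat)"
        using two fact_reduce[of "card B - 1", where ?'a = nat]
        by (simp add: numeral_2_eq_2 mult.commute)
      finally show ?thesis using rhs by (simp add: D_def mult.assoc)
    qed
  qed
qed


section \<open>Eulerian closed walks in complete digraphs\<close>

definition complete_arcs :: "'v set \<Rightarrow> ('v \<times> 'v) set" where
  "complete_arcs e = {(x, y). x \<in> e \<and> y \<in> e \<and> x \<noteq> y}"

lemma finite_complete_arcs: "finite e \<Longrightarrow> finite (complete_arcs e)"
  by (rule finite_subset[of _ "e \<times> e"]) (auto simp: complete_arcs_def)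

lemma complete_arcs_Image: "complete_arcs e `` {x} = (if x \<in> e then e - {x} else {})"
  and complete_arcs_converse_Image: "(complete_arcs e)\<inverse> `` {x} = (if x \<in> e then e - {x} else {})"
  by (auto simp: complete_arcs_def)

lemma card_complete_arcs: "finite e \<Longrightarrow> card (complete_arcs e) = card e * (card e - 1)"
proof -
  assume "finite e"
  have "complete_arcs e = Sigma e (\<lambda>x. e - {x})" by (auto simp: complete_arcs_def)
  thus ?thesis using \<open>finite e\<close> by simp
qed

lemma Domain_complete_arcs: "card e \<ge> 2 \<Longrightarrow> Domain (complete_arcs e) = e"
proof -
  assume "card e \<ge> 2"
  hence "e - {x} \<noteq> {}" for x
    using card_mono[of "{x}" e] by (auto simp flip: subset_singleton_iff simp: subset_iff)
  thus ?thesis by (fastforce simp: complete_arcs_def)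
qed

text \<open>The absence of loops in the complete digraph is no restriction: acyclicity for the
  singleton \<open>{x}\<close> already excludes \<open>f x = x\<close>.\<close>

lemma arborescences_complete:
  assumes "card e \<ge> 2" "r \<in> e"
  shows "arborescences (complete_arcs e) r = rooted_forests e {r}"
proof -
  have "f \<in> Pi\<^sub>E (e - {r}) (\<lambda>x. complete_arcs e `` {x}) \<longleftrightarrow> f \<in> (e - {r}) \<rightarrow>\<^sub>E e"
    if "\<forall>S. S \<subseteq> e - {r} \<longrightarrow> S \<noteq> {} \<longrightarrow> (\<exists>x\<in>S. f x \<notin> S)" for f
  proof -
    have "f x \<noteq> x" if "x \<in> e - {r}" for x
      using spec[OF \<open>\<forall>S. _ S\<close>, of "{x}"] that by auto
    thus ?thesis by (auto simp: PiE_iff complete_arcs_Image)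
  qed
  thus ?thesis unfolding arborescences_def rooted_forests_def Domain_complete_arcs[OF assms(1)]
    by blast
qed

text \<open>All out-degrees are \<open>k - 1\<close>, so the root contributes (k-1)! and each of the
  other \<open>k - 1\<close> vertices (k-2)!; Cayley's formula with a single root gives k^(k-2)
  trees.\<close>

lemma euler_walks_complete:
  assumes "card e = k" "k \<ge> 2" "r \<in> e"
  shows "euler_walks (k * (k - 1)) r r (complete_arcs e) =
    fact (k - 1) * fact (k - 2) ^ (k - 1) * k ^ (k - 2)"
proof -
  have fin: "finite e" using assms by (intro card_ge_0_finite) auto
  have "card (rooted_forests e {r}) * k = k ^ (k - 1)"
    using card_rooted_forests[of e "{r}"] fin assms by simp
  also have "\<dots> = k ^ (k - 2) * k"
    using assms(2) by (metis Suc_1 Suc_diff_Suc Suc_le_lessD power_Suc2 diff_Suc_1 One_nat_def)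
  finally have trees: "card (rooted_forests e {r}) = k ^ (k - 2)" using assms(2) by simp
  have "(\<Prod>x\<in>e - {r}. fact (card (complete_arcs e `` {x}) - 1)) = (\<Prod>x\<in>e - {r}. fact (k - 2) :: nat)"
    using assms fin by (intro prod.cong) (auto simp: complete_arcs_Image numeral_2_eq_2)
  also have "\<dots> = fact (k - 2) ^ (k - 1)"
    using assms fin by simp
  finally show ?thesis
    using assms fin
    by (subst euler_walks_eq)
       (simp_all add: finite_complete_arcs card_complete_arcs Domain_complete_arcs
          complete_arcs_converse_Image arborescences_complete trees, 
        simp_all add: complete_arcs_Image)
qed


section \<open>Formal derivatives and coefficients\<close>

definition monomial_fact :: "('v \<Rightarrow>\<^sub>0 nat) \<Rightarrow> 'a::field_char_0" where
  "monomial_fact m = (\<Prod>v\<in>Poly_Mapping.keys m. fact (Poly_Mapping.lookup m v))"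

lemma monomial_fact_superset:
  assumes "finite A" "Poly_Mapping.keys m \<subseteq> A"
  shows "monomial_fact m = (\<Prod>v\<in>A. fact (Poly_Mapping.lookup m v))"
  unfolding monomial_fact_def
  using assms by (intro prod.mono_neutral_left) (auto simp: in_keys_iff)

lemma monomial_fact_0 [simp]: "monomial_fact 0 = 1"
  by (simp add: monomial_fact_def)

lemma monomial_fact_single: "monomial_fact (Poly_Mapping.single v c) = fact c"
  by (subst monomial_fact_superset[of "{v}"]) auto

lemma monomial_fact_add_single:
  "monomial_fact (m + Poly_Mapping.single v 1) =
     (of_nat (Suc (Poly_Mapping.lookup m v)) * monomial_fact m :: 'a::field_char_0)"
proof -
  define A where "A = insert v (Poly_Mapping.keys m)"
  have A: "finite A" "v \<in> A" "Poly_Mapping.keys m \<subseteq> A"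
    "Poly_Mapping.keys (m + Poly_Mapping.single v 1) \<subseteq> A"
    using Poly_Mapping.keys_add[of m "Poly_Mapping.single v 1"] by (auto simp: A_def)
  have "(\<Prod>x\<in>A - {v}. fact (Poly_Mapping.lookup (m + Poly_Mapping.single v 1) x)) =
        (\<Prod>x\<in>A - {v}. fact (Poly_Mapping.lookup m x) :: 'a)"
    by (intro prod.cong) (auto simp: lookup_add lookup_single)
  thus ?thesis
    using A by (simp add: monomial_fact_superset[of A] prod.remove[of A v] lookup_add mult_ac)
qed

lemma minus_single_eq_iff:
  fixes m' :: "'v \<Rightarrow>\<^sub>0 nat"
  assumes "Poly_Mapping.lookup m' v \<noteq> 0"
  shows "m' - Poly_Mapping.single v 1 = m \<longleftrightarrow> m' = m + Poly_Mapping.single v 1"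
proof
  assume "m' - Poly_Mapping.single v 1 = m"
  thus "m' = m + Poly_Mapping.single v 1"
    using assms by (intro poly_mapping_eqI) (auto simp: lookup_add lookup_minus lookup_single when_def)
qed simp

text \<open>Lowering the exponent of \<open>v\<close> is injective on the monomials that contain
  \<open>v\<close>, so only one monomial of \<open>p\<close> can contribute to the coefficient at
  \<open>m\<close>.\<close>

lemma lookup_entry_pderiv:
  "Poly_Mapping.lookup (entry_pderiv v p) m =
     of_nat (Suc (Poly_Mapping.lookup m v)) * Poly_Mapping.lookup p (m + Poly_Mapping.single v 1)"
proof -
  let ?s = "Poly_Mapping.single v (1 :: nat)"
  have "Poly_Mapping.lookup (entry_pderiv v p) m =
    (\<Sum>m'\<in>Poly_Mapping.keys p.
       if m' = m + ?s then of_nat (Suc (Poly_Mapping.lookup m v)) * Poly_Mapping.lookup p (m + ?s)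
       else 0)"
    unfolding entry_pderiv_def lookup_sum
  proof (intro sum.cong refl)
    fix m'
    show "Poly_Mapping.lookup (Poly_Mapping.single (m' - ?s)
            (of_nat (Poly_Mapping.lookup m' v) * Poly_Mapping.lookup p m')) m =
          (if m' = m + ?s then of_nat (Suc (Poly_Mapping.lookup m v)) *
             Poly_Mapping.lookup p (m + ?s) else 0)"
    proof (cases "Poly_Mapping.lookup m' v = 0")
      case True
      hence "m' \<noteq> m + ?s" by (auto simp: lookup_add)
      thus ?thesis using True by simp
    next
      case False
      thus ?thesis using minus_single_eq_iff[OF False, of m]
        by (auto simp: lookup_single lookup_add when_def)
    qed
  qed
  also have "\<dots> = of_nat (Suc (Poly_Mapping.lookup m v)) * Poly_Mapping.lookup p (m + ?s)"
    by (simp add: in_keys_iff)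
  finally show ?thesis .
qed

text \<open>Rescaled by factorials, coefficients are merely shifted by differentiation.\<close>

definition dcoeff :: "'a::field_char_0 entry_poly \<Rightarrow> ((nat \<times> nat) \<Rightarrow>\<^sub>0 nat) \<Rightarrow> 'a" where
  "dcoeff p m = monomial_fact m * Poly_Mapping.lookup p m"

lemma dcoeff_0_right: "dcoeff p 0 = Poly_Mapping.lookup p 0"
  by (simp add: dcoeff_def)

lemma dcoeff_entry_pderiv: "dcoeff (entry_pderiv v p) m = dcoeff p (m + Poly_Mapping.single v 1)"
  unfolding dcoeff_def lookup_entry_pderiv monomial_fact_add_single by (simp add: mult_ac)

lemma dcoeff_sum: "dcoeff (\<Sum>x\<in>A. f x) m = (\<Sum>x\<in>A. dcoeff (f x) m)"
  by (simp add: dcoeff_def lookup_sum sum_distrib_left)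

lemma lookup_single_times:
  "Poly_Mapping.lookup (Poly_Mapping.single a c * p) m =
     c * Sum_any (\<lambda>q. Poly_Mapping.lookup p q when m = a + q)"
  by (simp add: lookup_mult lookup_single when_mult)

lemma lookup_entry_const_times:
  "Poly_Mapping.lookup (entry_const c * p) m = c * Poly_Mapping.lookup p m"
  by (simp add: entry_const_def lookup_single_times)

lemma dcoeff_entry_const_times: "dcoeff (entry_const c * p) m = c * dcoeff p m"
  by (simp add: dcoeff_def lookup_entry_const_times)

section \<open>Expansion of composed operators over families of stars\<close>

definition star_monomial :: "nat \<Rightarrow> nat list \<Rightarrow> (nat \<times> nat) \<Rightarrow>\<^sub>0 nat" where
  "star_monomial i y = (\<Sum>j\<leftarrow>y. Poly_Mapping.single (i, j) 1)"

lemma dcoeff_foldr_entry_pderiv: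
  "dcoeff (foldr (\<lambda>j. entry_pderiv (i, j)) y p) m = dcoeff p (m + star_monomial i y)"
  by (induction y arbitrary: m) (simp_all add: star_monomial_def dcoeff_entry_pderiv add.assoc)

definition tuples :: "nat \<Rightarrow> nat \<Rightarrow> nat list set" where
  "tuples k n = {y. length y = k - 1 \<and> set y \<subseteq> {1..n}}"

lemma finite_tuples: "finite (tuples k n)"
  using finite_lists_length_eq[of "{1..n}" "k - 1"] by (simp add: tuples_def conj_commute)

lemma dcoeff_tensor_diff_op:
  "dcoeff (tensor_diff_op k n T i p) m =
     (\<Sum>y\<in>tuples k n. T (i # y) * dcoeff p (m + star_monomial i y))"
  by (simp add: tensor_diff_op_def dcoeff_sum dcoeff_entry_const_times dcoeff_foldr_entry_pderiv
      tuples_def)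

text \<open>Lists of pairs are used because an index may occur several times in \<open>w\<close>,
  and each occurrence chooses its own label. A pair of an index and a tuple stands for the star with
  that centre and those heads.\<close>

definition labelings :: "('i \<Rightarrow> 'y set) \<Rightarrow> 'i list \<Rightarrow> ('i \<times> 'y) list set" where
  "labelings B w = {zs. map fst zs = w \<and> (\<forall>z\<in>set zs. snd z \<in> B (fst z))}"

lemma labelings_Nil: "labelings B [] = {[]}"
  by (auto simp: labelings_def)

lemma labelings_Cons:
  "labelings B (i # w) = (\<lambda>(y, zs). (i, y) # zs) ` (B i \<times> labelings B w)"
  by (auto simp: labelings_def image_iff Cons_eq_map_conv)

lemma inj_on_labelings_Cons: "inj_on (\<lambda>(y, zs). (i, y) # zs) A"
  by (auto simp: inj_on_def)

lemma finite_labelings: "(\<And>i. finite (B i)) \<Longrightarrow> finite (labelings B w)"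
  by (induction w) (auto simp: labelings_Nil labelings_Cons)

lemma card_labelings: "card (labelings B w) = (\<Prod>i\<leftarrow>w. card (B i))"
  by (induction w)
     (simp_all add: labelings_Nil labelings_Cons card_image inj_on_labelings_Cons card_cartesian_product)

text \<open>Monomials are read as multisets of arcs: the exponent of a pair is the multiplicity of
  that arc in the family of stars.\<close>

definition arc_monomial :: "(nat \<times> nat list) list \<Rightarrow> (nat \<times> nat) \<Rightarrow>\<^sub>0 nat" where
  "arc_monomial zs = (\<Sum>z\<leftarrow>zs. star_monomial (fst z) (snd z))"

definition tensor_weight :: "'a::comm_monoid_mult tensor \<Rightarrow> (nat \<times> nat list) list \<Rightarrow> 'a" where
  "tensor_weight T zs = (\<Prod>z\<leftarrow>zs. T (fst z # snd z))"

text \<open>Every letter of \<open>w\<close> picks a star independently of the others, multiplies by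
  the corresponding tensor entry and shifts the exponents by the arcs of the star.\<close>

lemma dcoeff_foldr_tensor_diff_op:
  "dcoeff (foldr (tensor_diff_op k n T) w p) m =
     (\<Sum>zs\<in>labelings (\<lambda>_. tuples k n) w. tensor_weight T zs * dcoeff p (m + arc_monomial zs))"
proof (induction w arbitrary: m)
  case Nil
  thus ?case by (simp add: labelings_Nil tensor_weight_def arc_monomial_def)
next
  case (Cons i w)
  show ?case
    unfolding labelings_Cons sum.reindex[OF inj_on_labelings_Cons]
    by (simp add: dcoeff_tensor_diff_op Cons.IH case_prod_beta tensor_weight_def arc_monomial_def
        sum_distrib_left sum.cartesian_product mult_ac add_ac)
qed

definition composition_word :: "nat \<Rightarrow> (nat \<Rightarrow> nat) \<Rightarrow> nat list" where
  "composition_word n c = concat (map (\<lambda>i. replicate (c i) i) [1..<Suc n])"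

text \<open>By linearity the normalising constants move to the front, and each power of an operator
  becomes a block of equal letters, so a single word remains to be expanded.\<close>

lemma dcoeff_foldr_scaled:
  "dcoeff (foldr (\<lambda>i p. entry_const (a i) * (tensor_diff_op k n T i ^^ c i) p) js p) m =
     (\<Prod>i\<leftarrow>js. a i) * dcoeff (foldr (tensor_diff_op k n T) (concat (map (\<lambda>i. replicate (c i) i) js)) p) m"
proof (induction js arbitrary: m)
  case (Cons i js)
  let ?F = "tensor_diff_op k n T"
  have pow: "dcoeff ((?F i ^^ r) q) m = b * dcoeff ((?F i ^^ r) q') m"
    if "\<And>m. dcoeff q m = b * dcoeff q' m" for q q' b r m
    using that by (induction r arbitrary: m)
      (simp_all add: dcoeff_tensor_diff_op sum_distrib_left mult_ac)
  have rep: "foldr ?F (replicate r i) q = (?F i ^^ r) q" for r q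
    by (induction r) auto
  show ?case using pow[OF Cons.IH, of "c i" m]
    by (simp add: dcoeff_entry_const_times rep mult_ac)
qed simp

lemma lookup_tensor_trace_term:
  "Poly_Mapping.lookup (tensor_trace_term k n d T c) 0 =
     (\<Prod>i=1..n. 1 / fact (c i * (k - 1))) *
     (\<Sum>zs\<in>labelings (\<lambda>_. tuples k n) (composition_word n c).
        tensor_weight T zs * dcoeff (mat_trace (generic_mat n ^\<^sub>m (d * (k - 1)))) (arc_monomial zs))"
proof -
  have "(\<Prod>i\<leftarrow>[1..<Suc n]. 1 / fact (c i * (k - 1))) = (\<Prod>i=1..n. 1 / fact (c i * (k - 1)) :: 'a)"
    by (subst prod.distinct_set_conv_list[symmetric]) (simp_all only: set_upt distinct_upt atLeastLessThanSuc_atLeastAtMost)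
  thus ?thesis
    unfolding dcoeff_0_right[symmetric] tensor_trace_term_def dcoeff_foldr_scaled
      composition_word_def dcoeff_foldr_tensor_diff_op by simp
qed


section \<open>Walk counts in powers of the generic matrix\<close>

text \<open>This counts walks of length \<open>L\<close> from \<open>u\<close> to \<open>v\<close>
  whose multiset of arcs is \<open>m\<close>. The recursion removes the first arc, matching
  multiplication by the generic matrix from the left.\<close>

fun walk_count :: "nat \<Rightarrow> nat \<Rightarrow> nat \<Rightarrow> nat \<Rightarrow> ((nat \<times> nat) \<Rightarrow>\<^sub>0 nat) \<Rightarrow> nat" where
  "walk_count n 0 u v m = (if u = v \<and> m = 0 then 1 else 0)"
| "walk_count n (Suc L) u v m =
     (\<Sum>w\<in>{w \<in> {1..n}. Poly_Mapping.lookup m (u, w) \<noteq> 0}.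
        walk_count n L w v (m - Poly_Mapping.single (u, w) 1))"

lemma walk_count_Suc_nonzeroE:
  assumes "walk_count n (Suc L) u v m \<noteq> 0"
  obtains w where "w \<in> {1..n}" "Poly_Mapping.lookup m (u, w) \<noteq> 0"
    "walk_count n L w v (m - Poly_Mapping.single (u, w) 1) \<noteq> 0"
  using assms unfolding walk_count.simps by (rule sum.not_neutral_contains_not_neutral) blast

lemma lookup_entry_var_times:
  "Poly_Mapping.lookup (entry_var v * p) m =
     (if Poly_Mapping.lookup m v \<noteq> 0 then Poly_Mapping.lookup p (m - Poly_Mapping.single v 1) else 0)"
proof (cases "Poly_Mapping.lookup m v = 0")
  case True
  hence "m \<noteq> Poly_Mapping.single v 1 + q" for q by (auto simp: lookup_add)
  thus ?thesis using True by (simp add: entry_var_def lookup_single_times)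
next
  case False
  have "m = Poly_Mapping.single v 1 + q \<longleftrightarrow> m - Poly_Mapping.single v 1 = q" for q
    using minus_single_eq_iff[OF False, of q] by (simp add: add.commute)
  thus ?thesis using False by (simp add: entry_var_def lookup_single_times)
qed

lemma generic_mat_carrier: "generic_mat n \<in> carrier_mat n n"
  by (simp add: generic_mat_def)

text \<open>Matrix powers unfold on the right, whereas walks are counted by their first arc.\<close>

lemma pow_mat_Suc_left:
  assumes "A \<in> carrier_mat n n"
  shows "A ^\<^sub>m Suc L = A * A ^\<^sub>m L"
proof (induction L)
  case 0
  thus ?case using assms by simp
next
  case (Suc L)
  have "A ^\<^sub>m Suc (Suc L) = (A * A ^\<^sub>m L) * A" using Suc.IH by simp
  also have "\<dots> = A * (A ^\<^sub>m L * A)" using assms by (intro assoc_mult_mat) auto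
  finally show ?case by simp
qed

lemma lookup_generic_mat_pow:
  assumes "i < n" "j < n"
  shows "Poly_Mapping.lookup ((generic_mat n ^\<^sub>m L) $$ (i, j)) m =
    (of_nat (walk_count n L (Suc i) (Suc j) m) :: 'a::comm_ring_1)"
  using assms
proof (induction L arbitrary: i m)
  case 0
  thus ?case by (simp add: generic_mat_def lookup_one when_def)
next
  case (Suc L)
  let ?A = "generic_mat n :: 'a entry_poly mat"
  have A: "?A \<in> carrier_mat n n" by (rule generic_mat_carrier)
  have "(?A ^\<^sub>m Suc L) $$ (i, j) = (\<Sum>l<n. entry_var (Suc i, Suc l) * (?A ^\<^sub>m L) $$ (l, j))"
    unfolding pow_mat_Suc_left[OF A] using Suc.prems A
    by (auto simp: scalar_prod_def generic_mat_def lessThan_atLeast0 intro!: sum.cong)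
  hence "Poly_Mapping.lookup ((?A ^\<^sub>m Suc L) $$ (i, j)) m =
    (\<Sum>l<n. if Poly_Mapping.lookup m (Suc i, Suc l) \<noteq> 0
      then of_nat (walk_count n L (Suc l) (Suc j) (m - Poly_Mapping.single (Suc i, Suc l) 1)) else 0)"
    using Suc by (auto simp: lookup_sum lookup_entry_var_times intro!: sum.cong)
  also have "\<dots> = (\<Sum>w\<in>{1..n}. if Poly_Mapping.lookup m (Suc i, w) \<noteq> 0
      then of_nat (walk_count n L w (Suc j) (m - Poly_Mapping.single (Suc i, w) 1)) else 0)"
    by (rule sum.reindex_bij_witness[where i = "\<lambda>w. w - 1" and j = Suc]) auto
  also have "\<dots> = of_nat (walk_count n (Suc L) (Suc i) (Suc j) m)"
    unfolding walk_count.simps of_nat_sum by (rule sum.inter_filter[symmetric]) simp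
  finally show ?case .
qed

lemma lookup_trace_generic_mat_pow:
  "Poly_Mapping.lookup (mat_trace (generic_mat n ^\<^sub>m L)) m =
     (\<Sum>u=1..n. of_nat (walk_count n L u u m))"
proof -
  have "Poly_Mapping.lookup (mat_trace (generic_mat n ^\<^sub>m L)) m =
    (\<Sum>i<n. of_nat (walk_count n L (Suc i) (Suc i) m))"
    using generic_mat_carrier[of n]
    by (auto simp: mat_trace_def lookup_sum lookup_generic_mat_pow intro!: sum.cong)
  also have "\<dots> = (\<Sum>u=1..n. of_nat (walk_count n L u u m))"
    by (rule sum.reindex_bij_witness[where i = "\<lambda>w. w - 1" and j = Suc]) auto
  finally show ?thesis .
qed

text \<open>A walk leaves every vertex as often as it enters it, apart from its two ends. The end
  terms make the removal of the first arc inductive and cancel for closed walks.\<close>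

lemma walk_count_balanced:
  assumes "walk_count n L u v m \<noteq> 0" "u \<in> {1..n}"
  shows "(\<Sum>w=1..n. Poly_Mapping.lookup m (x, w)) + of_bool (x = v) =
    (\<Sum>w=1..n. Poly_Mapping.lookup m (w, x)) + of_bool (x = u)"
  using assms
proof (induction L arbitrary: u m)
  case 0
  thus ?case by (auto split: if_splits)
next
  case (Suc L)
  obtain w where w: "w \<in> {1..n}" "Poly_Mapping.lookup m (u, w) \<noteq> 0"
    and nz: "walk_count n L w v (m - Poly_Mapping.single (u, w) 1) \<noteq> 0"
    using Suc.prems(1) by (rule walk_count_Suc_nonzeroE)
  define m' where "m' = m - Poly_Mapping.single (u, w) 1"
  have m: "m = m' + Poly_Mapping.single (u, w) 1"
    using minus_single_eq_iff[OF w(2), of m'] by (simp add: m'_def)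
  have "(\<Sum>y=1..n. Poly_Mapping.lookup (Poly_Mapping.single (u, w) (1 :: nat)) (x, y)) = of_bool (x = u)"
    using w(1) by (simp add: lookup_single when_def sum.delta' conj_commute if_distrib cong: if_cong)
  hence 1: "(\<Sum>y=1..n. Poly_Mapping.lookup m (x, y)) =
      (\<Sum>y=1..n. Poly_Mapping.lookup m' (x, y)) + of_bool (x = u)"
    by (simp only: m lookup_add sum.distrib)
  have "(\<Sum>y=1..n. Poly_Mapping.lookup (Poly_Mapping.single (u, w) (1 :: nat)) (y, x)) = of_bool (x = w)"
    using Suc.prems(2) by (simp add: lookup_single when_def)
  hence 2: "(\<Sum>y=1..n. Poly_Mapping.lookup m (y, x)) =
      (\<Sum>y=1..n. Poly_Mapping.lookup m' (y, x)) + of_bool (x = w)"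
    by (simp only: m lookup_add sum.distrib)
  show ?case using Suc.IH[OF nz w(1)] 1 2 unfolding m'_def[symmetric] by linarith
qed

text \<open>A walk consisting of loops never leaves its starting vertex, so loops at two different
  vertices cannot occur together.\<close>

lemma walk_count_loops:
  assumes "walk_count n L u v m \<noteq> 0" "\<And>x y. Poly_Mapping.lookup m (x, y) \<noteq> 0 \<Longrightarrow> x = y"
    and "Poly_Mapping.lookup m (x, y) \<noteq> 0"
  shows "x = u"
  using assms
proof (induction L arbitrary: u m)
  case 0
  thus ?case by (auto split: if_splits)
next
  case (Suc L)
  obtain w where w: "Poly_Mapping.lookup m (u, w) \<noteq> 0"
    and nz: "walk_count n L w v (m - Poly_Mapping.single (u, w) 1) \<noteq> 0"
    using Suc.prems(1) by (rule walk_count_Suc_nonzeroE)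
  have [simp]: "w = u" using Suc.prems(2)[OF w] by simp
  show ?case
  proof (cases "(x, y) = (u, u)")
    case False
    have "x = w"
    proof (rule Suc.IH[OF nz])
      show "a = b" if "Poly_Mapping.lookup (m - Poly_Mapping.single (u, w) 1) (a, b) \<noteq> 0" for a b
        using that by (intro Suc.prems(2)) (auto simp: lookup_minus)
      show "Poly_Mapping.lookup (m - Poly_Mapping.single (u, w) 1) (x, y) \<noteq> 0"
        using False Suc.prems(3) by (auto simp: lookup_minus lookup_single when_def)
    qed
    thus ?thesis by simp
  qed simp
qed

lemma walk_count_single_loop:
  "i \<in> {1..n} \<Longrightarrow> walk_count n L i i (Poly_Mapping.single (i, i) L) = 1"
proof (induction L)
  case (Suc L)
  have "{w \<in> {1..n}. Poly_Mapping.lookup (Poly_Mapping.single (i, i) (Suc L)) (i, w) \<noteq> 0} = {i}"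
    using Suc.prems by (auto simp: lookup_single when_def split: if_splits)
  moreover have "Poly_Mapping.single (i, i) (Suc L) - Poly_Mapping.single (i, i) 1 =
      Poly_Mapping.single (i, i) L"
    by (simp flip: single_diff)
  ultimately show ?case using Suc by (simp only: walk_count.simps sum.insert) simp
qed simp

text \<open>The length must be positive: the empty walk would be counted once at each of the
  \<open>n\<close> vertices.\<close>

lemma sum_walk_count_single_loop:
  assumes "i \<in> {1..n}" "L > 0"
  shows "(\<Sum>u=1..n. walk_count n L u u (Poly_Mapping.single (i, i) L)) = 1"
proof -
  obtain L' where L: "L = Suc L'" using assms(2) by (cases L) auto
  have "walk_count n L u u (Poly_Mapping.single (i, i) L) = 0" if "u \<noteq> i" for u
    using that by (simp add: L lookup_single)
  hence "(\<Sum>u=1..n. walk_count n L u u (Poly_Mapping.single (i, i) L)) =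
      (\<Sum>u\<in>{i}. walk_count n L u u (Poly_Mapping.single (i, i) L))"
    using assms(1) by (intro sum.mono_neutral_right) auto
  thus ?thesis using walk_count_single_loop[OF assms(1), of L] by simp
qed

section \<open>Squarefree monomials and Eulerian walks\<close>

definition set_monomial :: "'v set \<Rightarrow> 'v \<Rightarrow>\<^sub>0 nat" where
  "set_monomial M = (\<Sum>a\<in>M. Poly_Mapping.single a 1)"

lemma lookup_set_monomial:
  "finite M \<Longrightarrow> Poly_Mapping.lookup (set_monomial M) a = of_bool (a \<in> M)"
  by (simp add: set_monomial_def lookup_sum lookup_single when_def)

lemma monomial_fact_set_monomial:
  assumes "finite M"
  shows "monomial_fact (set_monomial M) = 1"
  unfolding monomial_fact_def by (rule prod.neutral) (simp add: lookup_set_monomial[OF assms])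

text \<open>The two recursions differ at length 0, where only \<open>walk_count\<close> checks that
  all arcs are used; \<open>card M = L\<close> guarantees this for \<open>euler_walks\<close> as
  well.\<close>

lemma walk_count_set_monomial:
  assumes "M \<subseteq> {1..n} \<times> {1..n}" "card M = L"
  shows "walk_count n L u v (set_monomial M) = euler_walks L u v M"
  using assms
proof (induction L arbitrary: u M)
  case 0
  hence "M = {}" using finite_subset[of M "{1..n} \<times> {1..n}"] by auto
  thus ?case by (simp add: set_monomial_def)
next
  case (Suc L)
  have fin: "finite M" using Suc.prems finite_subset[of M "{1..n} \<times> {1..n}"] by auto
  have "{w \<in> {1..n}. Poly_Mapping.lookup (set_monomial M) (u, w) \<noteq> 0} = M `` {u}"
    using Suc.prems by (auto simp: lookup_set_monomial[OF fin])
  moreover have "walk_count n L w v (set_monomial M - Poly_Mapping.single (u, w) 1) =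
      euler_walks L w v (M - {(u, w)})" if "w \<in> M `` {u}" for w
  proof -
    have uw: "(u, w) \<in> M" using that by simp
    have "set_monomial M = set_monomial (M - {(u, w)}) + Poly_Mapping.single (u, w) 1"
      unfolding set_monomial_def using sum.remove[OF fin uw] by (simp add: add.commute)
    thus ?thesis using Suc.IH[of "M - {(u, w)}" w] Suc.prems fin uw by auto
  qed
  ultimately show ?case by simp
qed


section \<open>Closed walks formed by stars\<close>

lemma lookup_star_monomial:
  "Poly_Mapping.lookup (star_monomial i y) (u, v) = (if u = i then count_list y v else 0)"
  by (induction y) (auto simp: star_monomial_def lookup_add lookup_single when_def)

lemma arc_monomial_Cons: "arc_monomial (z # zs) = star_monomial (fst z) (snd z) + arc_monomial zs"
  by (simp add: arc_monomial_def)

lemma lookup_arc_monomial_nonzero_iff: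
  "Poly_Mapping.lookup (arc_monomial zs) (u, v) \<noteq> 0 \<longleftrightarrow> (\<exists>z\<in>set zs. fst z = u \<and> v \<in> set (snd z))"
proof (induction zs)
  case Nil
  thus ?case by (simp add: arc_monomial_def)
next
  case (Cons z zs)
  have "Poly_Mapping.lookup (arc_monomial (z # zs)) (u, v) \<noteq> 0 \<longleftrightarrow>
    Poly_Mapping.lookup (star_monomial (fst z) (snd z)) (u, v) \<noteq> 0 \<or>
    Poly_Mapping.lookup (arc_monomial zs) (u, v) \<noteq> 0"
    by (simp add: arc_monomial_Cons lookup_add)
  also have "\<dots> \<longleftrightarrow> (\<exists>z\<in>set (z # zs). fst z = u \<and> v \<in> set (snd z))"
    unfolding Cons.IH lookup_star_monomial by (auto simp: count_list_0_iff)
  finally show ?case .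
qed

lemma count_list_le_1: "distinct y \<Longrightarrow> count_list y v \<le> 1"
  by (induction y) auto

text \<open>Stars with different centres share no arc, and a star with distinct heads repeats
  none.\<close>

lemma lookup_arc_monomial_le_1:
  assumes "distinct (map fst zs)" "\<forall>z\<in>set zs. distinct (snd z)"
  shows "Poly_Mapping.lookup (arc_monomial zs) (u, v) \<le> 1"
  using assms
proof (induction zs)
  case Nil
  thus ?case by (simp add: arc_monomial_def)
next
  case (Cons z zs)
  have "Poly_Mapping.lookup (arc_monomial zs) (u, v) = 0" if "u = fst z"
  proof -
    have "u \<notin> fst ` set zs" using Cons.prems(1) that by simp
    thus ?thesis using lookup_arc_monomial_nonzero_iff[of zs u v] by blast
  qed
  thus ?case using Cons count_list_le_1[of "snd z" v]
    by (auto simp: arc_monomial_Cons lookup_add lookup_star_monomial)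
qed

definition is_loop_star :: "nat \<Rightarrow> nat \<times> nat list \<Rightarrow> bool" where
  "is_loop_star k z \<longleftrightarrow> snd z = replicate (k - 1) (fst z)"

definition is_edge_star :: "nat \<Rightarrow> nat set set \<Rightarrow> nat \<times> nat list \<Rightarrow> bool" where
  "is_edge_star k E z \<longleftrightarrow> length (snd z) = k - 1 \<and> set (fst z # snd z) \<in> E"

lemma edge_star_distinct:
  assumes "card e = k" "k \<ge> 1" "length y = k - 1" "set (i # y) = e"
  shows "distinct (i # y)"
  using assms by (intro card_distinct) simp

text \<open>
  In a balanced arc set every head of an arc leaving an edge star is itself the centre of an edge
  star. So one edge star forces \<open>k\<close> of them, with pairwise different centres that fill the edge.
\<close>

lemma closed_walk_stars_cases:
  assumes k: "k \<ge> 2" and E: "uniform_hypergraph k {1..n} E"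
    and len: "length zs \<le> k"
    and stars: "\<And>z. z \<in> set zs \<Longrightarrow> is_loop_star k z \<or> is_edge_star k E z"
    and walk: "walk_count n L u u (arc_monomial zs) \<noteq> 0" and u: "u \<in> {1..n}"
  shows "zs = replicate (length zs) (u, replicate (k - 1) u) \<or>
    length zs = k \<and> (\<exists>e\<in>E. set (map fst zs) = e \<and> (\<forall>z\<in>set zs. is_edge_star k E z \<and> set (fst z # snd z) = e))"
proof (cases "\<exists>z\<in>set zs. is_edge_star k E z")
  case False
  have loop: "is_loop_star k z" if "z \<in> set zs" for z using stars[OF that] False that by blast
  have "z = (u, replicate (k - 1) u)" if z: "z \<in> set zs" for z
  proof -
    have "Poly_Mapping.lookup (arc_monomial zs) (fst z, fst z) \<noteq> 0"
      unfolding lookup_arc_monomial_nonzero_iff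
      using loop[OF z] z k by (intro bexI[of _ z]) (auto simp: is_loop_star_def)
    moreover have "x = y" if "Poly_Mapping.lookup (arc_monomial zs) (x, y) \<noteq> 0" for x y
      using that loop unfolding lookup_arc_monomial_nonzero_iff
      by (auto simp: is_loop_star_def)
    ultimately have "fst z = u" using walk_count_loops[OF walk] by blast
    thus ?thesis using loop[OF z] by (simp add: is_loop_star_def prod_eq_iff)
  qed
  thus ?thesis using replicate_eqI[of zs "length zs"] by blast
next
  case True
  define m where "m = arc_monomial zs"
  have bal: "(\<Sum>w=1..n. Poly_Mapping.lookup m (x, w)) = (\<Sum>w=1..n. Poly_Mapping.lookup m (w, x))" for x
    using walk_count_balanced[OF walk u, of x] by (simp add: m_def)
  have edge: "e \<subseteq> {1..n}" "card e = k" if "e \<in> E" for e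
    using E that by (auto simp: uniform_hypergraph_def)
  have cover: "\<exists>z'\<in>set zs. is_edge_star k E z' \<and> fst z' = j"
    if z: "z \<in> set zs" "is_edge_star k E z" and j: "j \<in> set (fst z # snd z)" for z j
  proof (cases "j = fst z")
    case True
    thus ?thesis using z by blast
  next
    case False
    have e: "set (fst z # snd z) \<in> E" using z(2) by (simp add: is_edge_star_def)
    have in_n: "fst z \<in> {1..n}" "j \<in> {1..n}" using edge(1)[OF e] j by auto
    have zj: "Poly_Mapping.lookup m (fst z, j) \<noteq> 0"
      unfolding m_def lookup_arc_monomial_nonzero_iff using z j False by auto
    \<comment> \<open>If nothing but loops left \<open>j\<close>, the arc from \<open>fst z\<close>
      to \<open>j\<close> would make the in-degree of \<open>j\<close> exceed its
      out-degree.\<close>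
    have "\<exists>w. w \<noteq> j \<and> Poly_Mapping.lookup m (j, w) \<noteq> 0"
    proof (rule ccontr)
      assume "\<not> ?thesis"
      hence "(\<Sum>w=1..n. Poly_Mapping.lookup m (j, w)) = (\<Sum>w\<in>{j}. Poly_Mapping.lookup m (j, w))"
        using in_n by (intro sum.mono_neutral_right) auto
      moreover have "(\<Sum>w=1..n. Poly_Mapping.lookup m (w, j)) \<ge> (\<Sum>w\<in>{fst z, j}. Poly_Mapping.lookup m (w, j))"
        using in_n by (intro sum_mono2) auto
      ultimately show False using bal[of j] zj False by simp
    qed
    then obtain w z' where "w \<noteq> j" "z' \<in> set zs" "fst z' = j" "w \<in> set (snd z')"
      unfolding m_def lookup_arc_monomial_nonzero_iff by blast
    moreover from this have "\<not> is_loop_star k z'" by (auto simp: is_loop_star_def)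
    ultimately show ?thesis using stars by blast
  qed
  obtain z0 where z0: "z0 \<in> set zs" "is_edge_star k E z0" using True by blast
  define e where "e = set (fst z0 # snd z0)"
  have eE: "e \<in> E" using z0(2) by (simp add: is_edge_star_def e_def)
  have sub: "set (fst z # snd z) \<subseteq> set (map fst zs)" if z: "z \<in> set zs" "is_edge_star k E z" for z
  proof
    fix j assume "j \<in> set (fst z # snd z)"
    then obtain z' where "z' \<in> set zs" "fst z' = j" using cover[OF z] by blast
    thus "j \<in> set (map fst zs)" by auto
  qed
  \<comment> \<open>All inequalities in the chain \<open>k = card e\<close>, number of centres,
    \<open>length zs\<close>, \<open>k\<close> are forced to be equalities.\<close>
  have le: "card (set (map fst zs)) \<le> length zs" using card_length[of "map fst zs"] by simp
  have ge: "card e \<le> card (set (map fst zs))" using sub[OF z0] by (intro card_mono) (auto simp: e_def)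
  have lenk: "length zs = k" using le ge len edge(2)[OF eE] by linarith
  have set_e: "set (map fst zs) = e"
    using card_subset_eq[of "set (map fst zs)" e] sub[OF z0] le ge lenk edge(2)[OF eE] by (simp add: e_def)
  have "distinct (map fst zs)" using set_e lenk edge(2)[OF eE] by (intro card_distinct) simp
  hence inj: "inj_on fst (set zs)" by (simp add: distinct_map)
  \<comment> \<open>Centres are distinct, so the edge star found by \<open>cover\<close> at the
    centre of \<open>z\<close> is \<open>z\<close> itself. Its edge lies within the set of centres,
    which has the same size.\<close>
  have "is_edge_star k E z \<and> set (fst z # snd z) = e" if z: "z \<in> set zs" for z
  proof -
    have "fst z \<in> set (fst z0 # snd z0)" using z set_e by (auto simp: e_def)
    then obtain z' where "z' \<in> set zs" "is_edge_star k E z'" "fst z' = fst z" using cover[OF z0] by blast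
    hence edge_z: "is_edge_star k E z" using inj z by (metis inj_onD)
    hence "set (fst z # snd z) \<in> E" by (simp add: is_edge_star_def)
    hence "set (fst z # snd z) = set (map fst zs)"
      using card_subset_eq[of "set (map fst zs)" "set (fst z # snd z)"] sub[OF z edge_z] edge(2) eE set_e
      by auto
    thus ?thesis using edge_z set_e by simp
  qed
  thus ?thesis using lenk eE set_e by blast
qed

section \<open>Compositions and their index words\<close>

lemma count_list_replicate_eq: "count_list (replicate r i) j = (if i = j then r else 0)"
  by (induction r) auto

lemma count_list_composition_word:
  assumes "j \<in> {1..n}"
  shows "count_list (composition_word n c) j = c j"
proof -
  have "count_list (concat (map (\<lambda>i. replicate (c i) i) js)) j = (if j \<in> set js then c j else 0)"
    if "distinct js" for js
    using that by (induction js) (auto simp: count_list_replicate_eq)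
  from this[of "[1..<Suc n]"] show ?thesis using assms by (auto simp: composition_word_def simp del: upt_Suc)
qed

lemma length_composition_word: "length (composition_word n c) = (\<Sum>i=1..n. c i)"
proof -
  have "length (composition_word n c) = (\<Sum>i\<leftarrow>[1..<Suc n]. c i)"
    by (simp add: composition_word_def length_concat o_def del: upt_Suc)
  also have "\<dots> = (\<Sum>i=1..n. c i)"
    by (subst sum.distinct_set_conv_list[symmetric])
       (simp_all only: set_upt distinct_upt atLeastLessThanSuc_atLeastAtMost)
  finally show ?thesis .
qed

lemma composition_eqI:
  assumes "c \<in> compositions n d" "c' \<in> compositions n d"
    and "\<And>j. j \<in> {1..n} \<Longrightarrow> c j = c' j"
  shows "c = c'"
  using assms by (intro PiE_ext[of c "{1..n}" "\<lambda>_. UNIV" c']) (simp_all add: compositions_def)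

text \<open>This and \<open>edge_composition\<close> are the only shapes with nonzero contributions.
  Both are restricted functions because compositions are extensional on
  \<open>{1..n}\<close>.\<close>

definition loop_composition :: "nat \<Rightarrow> nat \<Rightarrow> nat \<Rightarrow> nat \<Rightarrow> nat" where
  "loop_composition n d i = (\<lambda>j\<in>{1..n}. if j = i then d else 0)"

definition edge_composition :: "nat \<Rightarrow> nat set \<Rightarrow> nat \<Rightarrow> nat" where
  "edge_composition n e = (\<lambda>j\<in>{1..n}. of_bool (j \<in> e))"

lemma loop_composition_in: "i \<in> {1..n} \<Longrightarrow> loop_composition n d i \<in> compositions n d"
  by (auto simp: compositions_def loop_composition_def)

lemma edge_composition_in:
  assumes "e \<subseteq> {1..n}" shows "edge_composition n e \<in> compositions n (card e)"
proof -
  have "(\<Sum>j=1..n. of_bool (j \<in> e)) = card e"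
    using assms by (simp add: Int_absorb1)
  thus ?thesis by (auto simp: compositions_def edge_composition_def)
qed

lemma composition_word_loop:
  assumes "i \<in> {1..n}"
  shows "composition_word n (loop_composition n d i) = replicate d i"
proof (rule replicate_eqI[symmetric, THEN sym])
  show "length (composition_word n (loop_composition n d i)) = d"
    using loop_composition_in[OF assms, of d] by (simp add: length_composition_word compositions_def)
  show "x = i" if "x \<in> set (composition_word n (loop_composition n d i))" for x
    using that by (auto simp: composition_word_def loop_composition_def split: if_splits)
qed

lemma composition_word_edge:
  "composition_word n (edge_composition n e) = filter (\<lambda>i. i \<in> e) [1..<Suc n]"
proof -
  have "concat (map (\<lambda>i. replicate (edge_composition n e i) i) xs) = filter (\<lambda>i. i \<in> e) xs"
    if "set xs \<subseteq> {1..n}" for xs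
    using that by (induction xs) (auto simp: edge_composition_def)
  moreover have "set [1..<Suc n] \<subseteq> {1..n}" by auto
  ultimately show ?thesis unfolding composition_word_def by blast
qed


section \<open>Evaluation of the trace\<close>

lemma star_monomial_replicate: "star_monomial i (replicate r i) = Poly_Mapping.single (i, i) r"
proof (rule poly_mapping_eqI)
  fix a :: "nat \<times> nat"
  show "Poly_Mapping.lookup (star_monomial i (replicate r i)) a =
        Poly_Mapping.lookup (Poly_Mapping.single (i, i) r) a"
    by (cases a) (auto simp: lookup_star_monomial count_list_replicate_eq lookup_single when_def)
qed

lemma arc_monomial_replicate:
  "arc_monomial (replicate d (i, replicate r i)) = Poly_Mapping.single (i, i) (d * r)"
  by (induction d)
     (simp_all add: arc_monomial_def star_monomial_replicate single_add)

text \<open>Every vertex of \<open>e\<close> is the centre of exactly one star, whose heads are the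
  other vertices, each once. Thus the orders chosen within the tuples do not affect the
  monomial.\<close>

lemma arc_monomial_edge_labeling:
  assumes e: "finite e" "card e = k" "k \<ge> 1"
    and zs: "distinct (map fst zs)" "set (map fst zs) = e"
      "\<And>z. z \<in> set zs \<Longrightarrow> length (snd z) = k - 1 \<and> set (fst z # snd z) = e"
  shows "arc_monomial zs = set_monomial (complete_arcs e)"
proof (rule poly_mapping_eqI)
  fix a :: "nat \<times> nat"
  obtain u v where a: "a = (u, v)" by fastforce
  have dist: "distinct (fst z # snd z)" if "z \<in> set zs" for z
    using zs(3)[OF that] e by (intro edge_star_distinct[of e k]) auto
  have "(\<exists>z\<in>set zs. fst z = u \<and> v \<in> set (snd z)) \<longleftrightarrow> (u, v) \<in> complete_arcs e"
  proof
    assume "\<exists>z\<in>set zs. fst z = u \<and> v \<in> set (snd z)"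
    then obtain z where z: "z \<in> set zs" "fst z = u" "v \<in> set (snd z)" by blast
    thus "(u, v) \<in> complete_arcs e" using zs(3)[OF z(1)] dist[OF z(1)] by (auto simp: complete_arcs_def)
  next
    assume uv: "(u, v) \<in> complete_arcs e"
    hence "u \<in> set (map fst zs)" using zs(2) by (simp add: complete_arcs_def)
    then obtain z where z: "z \<in> set zs" "fst z = u" by auto
    thus "\<exists>z\<in>set zs. fst z = u \<and> v \<in> set (snd z)"
      using zs(3)[OF z(1)] uv by (intro bexI[of _ z]) (auto simp: complete_arcs_def)
  qed
  hence "Poly_Mapping.lookup (arc_monomial zs) (u, v) \<noteq> 0 \<longleftrightarrow> (u, v) \<in> complete_arcs e"
    by (simp only: lookup_arc_monomial_nonzero_iff)
  moreover have "Poly_Mapping.lookup (arc_monomial zs) (u, v) \<le> 1"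
    using zs(1) dist by (intro lookup_arc_monomial_le_1) auto
  ultimately show "Poly_Mapping.lookup (arc_monomial zs) a =
      Poly_Mapping.lookup (set_monomial (complete_arcs e)) a"
    using e(1) by (auto simp: a lookup_set_monomial finite_complete_arcs)
qed

text \<open>The trace counts closed walks with a marked start, whence the factor \<open>k\<close>.
  Outside \<open>e\<close> no walk of positive length can start.\<close>

lemma sum_euler_walks_complete:
  assumes "e \<subseteq> {1..n}" "card e = k" "k \<ge> 2"
  shows "(\<Sum>u=1..n. walk_count n (k * (k - 1)) u u (set_monomial (complete_arcs e))) =
    k * (fact (k - 1) * fact (k - 2) ^ (k - 1) * k ^ (k - 2))"
proof -
  have fin: "finite e" using assms by (auto intro: finite_subset)
  have "complete_arcs e \<subseteq> {1..n} \<times> {1..n}" using assms by (auto simp: complete_arcs_def)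
  hence walk: "walk_count n (k * (k - 1)) u u (set_monomial (complete_arcs e)) =
      euler_walks (k * (k - 1)) u u (complete_arcs e)" for u
    using fin assms by (intro walk_count_set_monomial) (simp_all add: card_complete_arcs)
  obtain L where L: "k * (k - 1) = Suc L" using assms(3) by (cases "k * (k - 1)") auto
  have "euler_walks (k * (k - 1)) u u (complete_arcs e) = 0" if "u \<notin> e" for u
    unfolding L using that by (simp add: complete_arcs_Image)
  hence "(\<Sum>u=1..n. euler_walks (k * (k - 1)) u u (complete_arcs e)) =
      (\<Sum>u\<in>e. euler_walks (k * (k - 1)) u u (complete_arcs e))"
    using assms by (intro sum.mono_neutral_right) auto
  also have "\<dots> = (\<Sum>u\<in>e. fact (k - 1) * fact (k - 2) ^ (k - 1) * k ^ (k - 2))"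
    using assms by (intro sum.cong refl euler_walks_complete) auto
  finally show ?thesis using assms by (simp only: walk sum_constant of_nat_id)
qed

text \<open>Covering \<open>k\<close> vertices with \<open>k\<close> entries leaves no room for
  repetition, so the tuples are the orderings of the vertices other than \<open>i\<close>.\<close>

lemma card_edge_stars:
  assumes "card e = k" "k \<ge> 2" "i \<in> e"
  shows "card {y. length y = k - 1 \<and> set (i # y) = e} = fact (k - 1)"
proof -
  have fin: "finite e" using assms by (intro card_ge_0_finite) auto
  have "{y. length y = k - 1 \<and> set (i # y) = e} = permutations_of_set (e - {i})"
  proof (intro equalityI subsetI)
    fix y assume "y \<in> {y. length y = k - 1 \<and> set (i # y) = e}"
    thus "y \<in> permutations_of_set (e - {i})"
      using edge_star_distinct[of e k y i] assms by (auto simp: permutations_of_set_def)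
  next
    fix y assume "y \<in> permutations_of_set (e - {i})"
    thus "y \<in> {y. length y = k - 1 \<and> set (i # y) = e}"
      using assms fin distinct_card[of y] by (auto simp: permutations_of_set_def)
  qed
  thus ?thesis using assms fin by simp
qed

text \<open>The parameter treats both tensors at once; it reappears in the result only as the
  \<open>k\<close>-th power of \<open>s\<close>.\<close>

definition signed_laplacian_tensor :: "real \<Rightarrow> nat \<Rightarrow> nat set set \<Rightarrow> real tensor" where
  "signed_laplacian_tensor s k E = (\<lambda>is. degree_tensor k E is + s * adjacency_tensor k E is)"

lemma laplacian_tensor_eq_signed: "laplacian_tensor k E = signed_laplacian_tensor (-1) k E"
  and signless_laplacian_tensor_eq_signed: "signless_laplacian_tensor k E = signed_laplacian_tensor 1 k E"
  by (simp_all add: laplacian_tensor_def signless_laplacian_tensor_def signed_laplacian_tensor_def)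

lemma degree_tensor_Cons:
  "k \<ge> 1 \<Longrightarrow> degree_tensor k E (i # y) = (if y = replicate (k - 1) i then real (vertex_degree E i) else 0)"
  by (cases k) (auto simp: degree_tensor_def)

lemma signed_laplacian_tensor_nonzeroD:
  assumes "k \<ge> 1" "length (snd z) = k - 1" "signed_laplacian_tensor s k E (fst z # snd z) \<noteq> 0"
  shows "is_loop_star k z \<or> is_edge_star k E z"
  using assms
  by (auto simp: signed_laplacian_tensor_def degree_tensor_Cons adjacency_tensor_def is_loop_star_def
      is_edge_star_def split: if_splits)

text \<open>A constant index list covers one vertex, which is not an edge as \<open>k\<close> is at
  least 2, so the adjacency part vanishes on the diagonal.\<close>

lemma signed_laplacian_tensor_loop:
  assumes "k \<ge> 2" "\<forall>e\<in>E. card e = k"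
  shows "signed_laplacian_tensor s k E (i # replicate (k - 1) i) = real (vertex_degree E i)"
proof -
  have "set (i # replicate (k - 1) i) = {i}" by auto
  hence "card (set (i # replicate (k - 1) i)) = 1" by (metis is_singletonI is_singleton_altdef)
  hence "set (i # replicate (k - 1) i) \<notin> E" using assms by force
  thus ?thesis using assms(1)
    by (simp add: signed_laplacian_tensor_def degree_tensor_Cons adjacency_tensor_def)
qed

lemma signed_laplacian_tensor_edge:
  assumes "k \<ge> 2" "e \<in> E" "card e = k" "length y = k - 1" "set (i # y) = e"
  shows "signed_laplacian_tensor s k E (i # y) = s / fact (k - 1)"
proof -
  have "distinct (i # y)" using assms by (intro edge_star_distinct[of e k]) auto
  hence "y \<noteq> replicate (k - 1) i" using assms(1) by (cases "k - 1") auto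
  thus ?thesis using assms
    by (simp add: signed_laplacian_tensor_def degree_tensor_Cons adjacency_tensor_def)
qed

section \<open>Contributions of single vertices and of edges\<close>

lemma tensor_weight_const:
  assumes "\<And>z. z \<in> set zs \<Longrightarrow> T (fst z # snd z) = a"
  shows "tensor_weight T zs = a ^ length zs"
  using assms by (induction zs) (simp_all add: tensor_weight_def)

lemma dcoeff_trace_generic_mat_pow:
  "dcoeff (mat_trace (generic_mat n ^\<^sub>m L)) m =
     monomial_fact m * of_nat (\<Sum>u=1..n. walk_count n L u u m)"
  by (simp add: dcoeff_def lookup_trace_generic_mat_pow)

definition trace_summand :: "nat \<Rightarrow> nat \<Rightarrow> nat \<Rightarrow> real tensor \<Rightarrow> (nat \<Rightarrow> nat) \<Rightarrow> (nat \<times> nat list) list \<Rightarrow> real" where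
  "trace_summand k n d T c zs = (\<Prod>i=1..n. 1 / fact (c i * (k - 1))) *
     (tensor_weight T zs * dcoeff (mat_trace (generic_mat n ^\<^sub>m (d * (k - 1)))) (arc_monomial zs))"

lemma tensor_trace_eq_sum_summands:
  "tensor_trace k n d T = of_nat (k - 1) ^ (n - 1) *
     (\<Sum>c\<in>compositions n d. \<Sum>zs\<in>labelings (\<lambda>_. tuples k n) (composition_word n c).
        trace_summand k n d T c zs)"
  by (simp add: tensor_trace_def lookup_sum lookup_tensor_trace_term trace_summand_def sum_distrib_left)

text \<open>The loop at \<open>i\<close> has multiplicity \<open>d * (k - 1)\<close>; its monomial
  factorial cancels the normalising factor at \<open>i\<close>, and there is exactly one closed
  walk. Only the tensor entries remain.\<close>

lemma trace_summand_loop: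
  assumes "k \<ge> 2" "\<forall>e\<in>E. card e = k" "i \<in> {1..n}" "d \<ge> 1"
  shows "trace_summand k n d (signed_laplacian_tensor s k E) (loop_composition n d i)
    (replicate d (i, replicate (k - 1) i)) = real (vertex_degree E i) ^ d"
proof -
  have "(\<Prod>j=1..n. 1 / fact (loop_composition n d i j * (k - 1)) :: real) =
        (\<Prod>j=1..n. if j = i then 1 / fact (d * (k - 1)) else 1)"
    by (intro prod.cong) (auto simp: loop_composition_def)
  also have "\<dots> = 1 / fact (d * (k - 1))" using assms(3) by simp
  finally have 1: "(\<Prod>j=1..n. 1 / fact (loop_composition n d i j * (k - 1)) :: real) =
    1 / fact (d * (k - 1))" .
  have 2: "tensor_weight (signed_laplacian_tensor s k E) (replicate d (i, replicate (k - 1) i)) =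
      real (vertex_degree E i) ^ d"
    by (subst tensor_weight_const[where a = "real (vertex_degree E i)"])
       (auto simp: signed_laplacian_tensor_loop[OF assms(1,2)] simp del: One_nat_def)
  have "(\<Sum>u=1..n. walk_count n (d * (k - 1)) u u (Poly_Mapping.single (i, i) (d * (k - 1)))) = 1"
    using assms by (intro sum_walk_count_single_loop) auto
  thus ?thesis
    unfolding trace_summand_def 1 2 dcoeff_trace_generic_mat_pow arc_monomial_replicate monomial_fact_single
    by simp
qed

definition edge_labelings :: "nat \<Rightarrow> nat \<Rightarrow> nat set \<Rightarrow> (nat \<times> nat list) list set" where
  "edge_labelings k n e =
     labelings (\<lambda>i. {y. length y = k - 1 \<and> set (i # y) = e}) (composition_word n (edge_composition n e))"

lemma card_edge_labelings:
  assumes "e \<subseteq> {1..n}" "card e = k" "k \<ge> 2"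
  shows "card (edge_labelings k n e) = fact (k - 1) ^ k"
proof -
  have "map (\<lambda>i. card {y. length y = k - 1 \<and> set (i # y) = e}) (composition_word n (edge_composition n e)) =
    map (\<lambda>_. fact (k - 1)) (composition_word n (edge_composition n e))"
    using card_edge_stars[OF assms(2,3)]
    by (intro map_cong refl) (simp add: composition_word_edge del: upt_Suc)
  moreover have "length (composition_word n (edge_composition n e)) = k"
    using edge_composition_in[OF assms(1)] assms(2) by (simp add: length_composition_word compositions_def)
  ultimately show ?thesis
    by (simp only: edge_labelings_def card_labelings map_replicate_const prod_list_replicate)
qed

text \<open>Each vertex of \<open>e\<close> carries one operator, hence one normalising factor
  1/(k-1)!. The arc monomial is squarefree, so no factorial compensates these factors here.\<close>

lemma trace_summand_edge:
  assumes "k \<ge> 2" "e \<in> E" "e \<subseteq> {1..n}" "card e = k" "zs \<in> edge_labelings k n e"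
  shows "trace_summand k n k (signed_laplacian_tensor s k E) (edge_composition n e) zs =
    (1 / fact (k - 1)) ^ k * ((s / fact (k - 1)) ^ k *
      real (k * (fact (k - 1) * fact (k - 2) ^ (k - 1) * k ^ (k - 2))))"
proof -
  have fin: "finite e" using assms by (auto intro: finite_subset)
  have fst_zs: "map fst zs = filter (\<lambda>i. i \<in> e) [1..<Suc n]"
    and z: "\<And>z. z \<in> set zs \<Longrightarrow> length (snd z) = k - 1 \<and> set (fst z # snd z) = e"
    using assms(5) by (auto simp: edge_labelings_def labelings_def composition_word_edge simp del: upt_Suc)
  have dist: "distinct (map fst zs)" and set_zs: "set (map fst zs) = e"
    using assms(3) unfolding fst_zs by auto
  have len: "length zs = k" using distinct_card[OF dist] set_zs assms(4) by simp
  have "(\<Prod>j=1..n. 1 / fact (edge_composition n e j * (k - 1)) :: real) =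
        (\<Prod>j\<in>e. 1 / fact (edge_composition n e j * (k - 1)))"
    using assms(3) by (intro prod.mono_neutral_right) (auto simp: edge_composition_def)
  also have "\<dots> = (\<Prod>j\<in>e. 1 / fact (k - 1))"
    using assms(3) by (intro prod.cong) (auto simp: edge_composition_def)
  finally have 1: "(\<Prod>j=1..n. 1 / fact (edge_composition n e j * (k - 1)) :: real) = (1 / fact (k - 1)) ^ k"
    using assms(4) by simp
  have 2: "tensor_weight (signed_laplacian_tensor s k E) zs = (s / fact (k - 1)) ^ k"
  proof -
    have "signed_laplacian_tensor s k E (fst x # snd x) = s / fact (k - 1)" if "x \<in> set zs" for x
      using signed_laplacian_tensor_edge[OF assms(1,2,4)] z[OF that] by blast
    thus ?thesis using tensor_weight_const[of zs "signed_laplacian_tensor s k E"] len by simp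
  qed
  have 3: "arc_monomial zs = set_monomial (complete_arcs e)"
    using fin assms dist set_zs z by (intro arc_monomial_edge_labeling[of e k]) auto
  show ?thesis
    unfolding trace_summand_def 1 2 3 dcoeff_trace_generic_mat_pow
      sum_euler_walks_complete[OF assms(3,4,1)]
      monomial_fact_set_monomial[OF finite_complete_arcs[OF fin]] by simp
qed


text \<open>A nonzero tensor weight makes every tuple a loop star or an edge star, and a nonzero
  walk count makes the case analysis of closed walks applicable. The centres then determine
  \<open>c\<close>, since \<open>c j\<close> counts the stars centred at \<open>j\<close>.\<close>

lemma trace_summand_nonzeroD:
  assumes k: "k \<ge> 2" and E: "uniform_hypergraph k {1..n} E" and d: "d \<in> {1..k}"
    and c: "c \<in> compositions n d"
    and zs: "zs \<in> labelings (\<lambda>_. tuples k n) (composition_word n c)"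
    and nz: "trace_summand k n d (signed_laplacian_tensor s k E) c zs \<noteq> 0"
  shows "(\<exists>i\<in>{1..n}. c = loop_composition n d i \<and> zs = replicate d (i, replicate (k - 1) i)) \<or>
    d = k \<and> (\<exists>e\<in>E. c = edge_composition n e \<and> zs \<in> edge_labelings k n e)"
proof -
  let ?T = "signed_laplacian_tensor s k E"
  have word: "map fst zs = composition_word n c"
    and tup: "\<And>z. z \<in> set zs \<Longrightarrow> snd z \<in> tuples k n"
    using zs by (auto simp: labelings_def)
  have len: "length zs = d"
    using arg_cong[OF word, of length] c by (simp add: length_composition_word compositions_def)
  have count: "c j = count_list (map fst zs) j" if "j \<in> {1..n}" for j
    unfolding word using count_list_composition_word[OF that] by simp
  have "tensor_weight ?T zs \<noteq> 0" using nz by (auto simp: trace_summand_def)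
  hence "?T (fst z # snd z) \<noteq> 0" if "z \<in> set zs" for z
    using that by (auto simp: tensor_weight_def prod_list_zero_iff)
  hence stars: "is_loop_star k z \<or> is_edge_star k E z" if "z \<in> set zs" for z
    using that tup[OF that] k by (intro signed_laplacian_tensor_nonzeroD[of k z s]) (auto simp: tuples_def)
  have "(\<Sum>u=1..n. walk_count n (d * (k - 1)) u u (arc_monomial zs)) \<noteq> 0"
    using nz unfolding trace_summand_def dcoeff_trace_generic_mat_pow by (metis mult_zero_right of_nat_0)
  then obtain u where u: "u \<in> {1..n}" "walk_count n (d * (k - 1)) u u (arc_monomial zs) \<noteq> 0"
    by (rule sum.not_neutral_contains_not_neutral)
  from closed_walk_stars_cases[OF k E _ stars u(2) u(1)] len d
  consider "zs = replicate d (u, replicate (k - 1) u)"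
    | e where "d = k" "e \<in> E" "set (map fst zs) = e"
        "\<forall>z\<in>set zs. is_edge_star k E z \<and> set (fst z # snd z) = e"
    by auto
  thus ?thesis
  proof cases
    case 1
    have "c = loop_composition n d u"
      using count by (intro composition_eqI[OF c loop_composition_in[OF u(1)]])
        (auto simp: 1 loop_composition_def count_list_replicate_eq)
    thus ?thesis using 1 u(1) by blast
  next
    case (2 e)
    have e: "e \<subseteq> {1..n}" "card e = k" using E 2(2) by (auto simp: uniform_hypergraph_def)
    have dist: "distinct (map fst zs)" using 2(1,3) e(2) len by (intro card_distinct) simp
    have "c = edge_composition n e"
    proof (rule composition_eqI[OF c])
      show "edge_composition n e \<in> compositions n d" using edge_composition_in[OF e(1)] e(2) 2(1) by simp
      fix j assume j: "j \<in> {1..n}"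
      have "count_list (map fst zs) j = of_bool (j \<in> e)"
        using count_list_le_1[OF dist, of j] count_list_0_iff[of "map fst zs" j] 2(3)
        by (cases "j \<in> e") auto
      thus "c j = edge_composition n e j" using count[OF j] j by (simp add: edge_composition_def)
    qed
    moreover from this have "zs \<in> edge_labelings k n e"
      using word 2(4) by (auto simp: edge_labelings_def labelings_def is_edge_star_def)
    ultimately show ?thesis using 2 by blast
  qed
qed

lemma edge_labelings_subset:
  assumes "e \<subseteq> {1..n}"
  shows "edge_labelings k n e \<subseteq> labelings (\<lambda>_. tuples k n) (composition_word n (edge_composition n e))"
  using assms by (fastforce simp: edge_labelings_def labelings_def tuples_def)

lemma edge_composition_inj:
  assumes "e \<subseteq> {1..n}" "e' \<subseteq> {1..n}" "edge_composition n e = edge_composition n e'"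
  shows "e = e'"
proof -
  have "j \<in> e \<longleftrightarrow> j \<in> e'" if "j \<in> {1..n}" for j
    using fun_cong[OF assms(3), of j] that
    by (cases "j \<in> e"; cases "j \<in> e'") (auto simp: edge_composition_def)
  thus ?thesis using assms(1,2) by blast
qed

text \<open>The support of the double sum is the disjoint union of two injective images, one of the
  vertices and, for \<open>d = k\<close>, one of the pairs of an edge and a labeling.\<close>

lemma sum_trace_summands:
  fixes s :: real
  assumes k: "k \<ge> 2" and E: "uniform_hypergraph k {1..n} E" and d: "d \<in> {1..k}"
  defines "T \<equiv> signed_laplacian_tensor s k E"
  shows "(\<Sum>c\<in>compositions n d. \<Sum>zs\<in>labelings (\<lambda>_. tuples k n) (composition_word n c).
            trace_summand k n d T c zs) =
    (\<Sum>i=1..n. real (vertex_degree E i) ^ d) +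
    (if d = k then \<Sum>e\<in>E. \<Sum>zs\<in>edge_labelings k n e. trace_summand k n k T (edge_composition n e) zs else 0)"
proof -
  define Z where "Z c = labelings (\<lambda>_. tuples k n) (composition_word n c)" for c
  define S where "S = Sigma (compositions n d) Z"
  define f where "f = (\<lambda>(c, zs). trace_summand k n d T c zs)"
  define hl where "hl i = (loop_composition n d i, replicate d (i, replicate (k - 1) i))" for i
  define he where "he = (\<lambda>(e, zs :: (nat \<times> nat list) list). (edge_composition n e, zs))"
  define X where "X = (if d = k then Sigma E (edge_labelings k n) else {})"
  have edge: "e \<subseteq> {1..n}" "card e = k" if "e \<in> E" for e
    using E that by (auto simp: uniform_hypergraph_def)
  have finE: "finite E" by (rule finite_subset[of _ "Pow {1..n}"]) (use edge in auto)
  have finZ: "finite (Z c)" for c by (simp add: Z_def finite_labelings finite_tuples)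
  have finS: "finite S" by (simp add: S_def finite_compositions finZ)
  have subl: "hl ` {1..n} \<subseteq> S"
  proof (rule image_subsetI)
    fix i assume i: "i \<in> {1..n}"
    have "replicate d (i, replicate (k - 1) i) \<in> Z (loop_composition n d i)"
      using i by (auto simp: Z_def labelings_def composition_word_loop tuples_def)
    thus "hl i \<in> S" using loop_composition_in[OF i] by (simp add: S_def hl_def)
  qed
  have sube: "he ` X \<subseteq> S"
  proof (rule image_subsetI)
    fix x assume x: "x \<in> X"
    then obtain e zs where x: "x = (e, zs)" "d = k" "e \<in> E" "zs \<in> edge_labelings k n e"
      by (auto simp: X_def split: if_splits)
    thus "he x \<in> S"
      using edge_composition_in[OF edge(1)[OF x(3)]] edge[OF x(3)] edge_labelings_subset[of e n k]
      by (auto simp: S_def he_def Z_def)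
  qed
  have disj: "hl ` {1..n} \<inter> he ` X = {}"
  proof -
    have False if i: "i \<in> {1..n}" and x: "x \<in> X" and eq: "hl i = he x" for i x
    proof -
      obtain e zs where x: "x = (e, zs)" "d = k" "e \<in> E" using x by (auto simp: X_def split: if_splits)
      \<comment> \<open>The left side is \<open>d = k\<close>, at least 2, while an edge composition
        only takes the values 0 and 1 on \<open>{1..n}\<close>.\<close>
      have "loop_composition n d i i = edge_composition n e i" using eq x by (simp add: hl_def he_def)
      thus False using i k x(2)
        by (cases "i \<in> e") (auto simp: loop_composition_def edge_composition_def)
    qed
    thus ?thesis by blast
  qed
  \<comment> \<open>As \<open>d\<close> is at least 1, the list in \<open>hl i\<close> is nonempty
    and reveals \<open>i\<close>.\<close>
  have injl: "inj_on hl {1..n}"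
    using d by (auto simp: inj_on_def hl_def)
  have inje: "inj_on he X"
    using edge_composition_inj[OF edge(1) edge(1)]
    by (intro inj_onI) (auto simp: he_def X_def split: if_splits)
  have "(\<Sum>c\<in>compositions n d. \<Sum>zs\<in>Z c. trace_summand k n d T c zs) = sum f S"
    unfolding S_def f_def using finite_compositions finZ by (subst sum.Sigma) auto
  also have "\<dots> = sum f (hl ` {1..n} \<union> he ` X)"
  proof (rule sum.mono_neutral_right[OF finS])
    show "hl ` {1..n} \<union> he ` X \<subseteq> S" using subl sube by blast
    show "\<forall>x\<in>S - (hl ` {1..n} \<union> he ` X). f x = 0"
    proof (rule ballI, rule ccontr)
      fix x assume x: "x \<in> S - (hl ` {1..n} \<union> he ` X)" and nz: "f x \<noteq> 0"
      obtain c zs where cz: "x = (c, zs)" by fastforce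
      have "c \<in> compositions n d" "zs \<in> Z c" using x cz by (auto simp: S_def)
      from trace_summand_nonzeroD[OF k E d this[unfolded Z_def], of s] nz
      have "x \<in> hl ` {1..n} \<union> he ` X"
        by (auto simp: cz f_def T_def hl_def he_def X_def image_iff)
      thus False using x by blast
    qed
  qed
  also have "\<dots> = sum f (hl ` {1..n}) + sum f (he ` X)"
    using finite_subset[OF sube finS] disj by (intro sum.union_disjoint) auto
  also have "sum f (hl ` {1..n}) = (\<Sum>i=1..n. real (vertex_degree E i) ^ d)"
    unfolding sum.reindex[OF injl]
  proof (intro sum.cong refl)
    fix i assume "i \<in> {1..n}"
    thus "(f \<circ> hl) i = real (vertex_degree E i) ^ d"
      using trace_summand_loop[OF k, of E i n d s] d edge(2) by (simp add: f_def hl_def T_def)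
  qed
  also have "sum f (he ` X) = (if d = k then \<Sum>e\<in>E. \<Sum>zs\<in>edge_labelings k n e.
      trace_summand k n k T (edge_composition n e) zs else 0)"
  proof (cases "d = k")
    case True
    have "finite (edge_labelings k n e)" if "e \<in> E" for e
      using edge_labelings_subset[OF edge(1)[OF that]] finZ finite_subset unfolding Z_def by blast
    thus ?thesis unfolding sum.reindex[OF inje] using True finE
      by (simp add: X_def sum.Sigma f_def he_def case_prod_beta)
  qed (simp add: X_def)
  finally show ?thesis by (simp add: Z_def)
qed

text \<open>The leading factor is the number of labelings of an edge and cancels the normalisation.
  In the rest, F = (k-1)! = (k-1) a with a = (k-2)! turns F a^(k-1) / F^k into 1 / (k-1)^(k-1), and
  k * k^(k-2) gives k^(k-1).\<close>

lemma edge_contribution_arith: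
  fixes s :: real
  assumes "k \<ge> 2"
  shows "fact (k - 1) ^ k * ((1 / fact (k - 1)) ^ k * ((s / fact (k - 1)) ^ k *
      real (k * (fact (k - 1) * fact (k - 2) ^ (k - 1) * k ^ (k - 2))))) =
    s ^ k * real k ^ (k - 1) / (real k - 1) ^ (k - 1)"
proof -
  obtain q where q: "k = Suc (Suc q)" using assms by (metis add_2_eq_Suc le_Suc_ex)
  define a F :: real where "a = fact q" and "F = fact (k - 1)"
  have nz: "a \<noteq> 0" "F \<noteq> 0" by (simp_all add: a_def F_def)
  have F: "F = (real k - 1) * a" by (simp add: q a_def F_def)
  have "real (k * (fact (k - 1) * fact (k - 2) ^ (k - 1) * k ^ (k - 2))) =
      real k ^ (k - 1) * (F * a ^ (k - 1))"
    by (simp add: q a_def F_def algebra_simps del: fact_Suc)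
  moreover have "F ^ k * (1 / F) ^ k = 1" using nz by (simp flip: power_mult_distrib)
  moreover have "(s / F) ^ k = s ^ k / (F * ((real k - 1) ^ (k - 1) * a ^ (k - 1)))"
  proof -
    have "F ^ k = F * F ^ (k - 1)" by (simp add: q)
    also have "F ^ (k - 1) = (real k - 1) ^ (k - 1) * a ^ (k - 1)"
      unfolding F by (rule power_mult_distrib)
    finally show ?thesis by (simp add: power_divide)
  qed
  ultimately show ?thesis
    using nz unfolding F_def[symmetric] mult.assoc[symmetric] by simp
qed

lemma sum_edge_summands:
  assumes k: "k \<ge> 2" and E: "uniform_hypergraph k {1..n} E"
  shows "(\<Sum>e\<in>E. \<Sum>zs\<in>edge_labelings k n e.
      trace_summand k n k (signed_laplacian_tensor s k E) (edge_composition n e) zs) =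
    s ^ k * real k ^ (k - 1) / (real k - 1) ^ (k - 1) * real (card E)"
proof -
  have edge: "e \<subseteq> {1..n}" "card e = k" if "e \<in> E" for e
    using E that by (auto simp: uniform_hypergraph_def)
  have "(\<Sum>zs\<in>edge_labelings k n e.
      trace_summand k n k (signed_laplacian_tensor s k E) (edge_composition n e) zs) =
      s ^ k * real k ^ (k - 1) / (real k - 1) ^ (k - 1)" if e: "e \<in> E" for e
    using trace_summand_edge[OF k e edge[OF e]] card_edge_labelings[OF edge[OF e] k]
      edge_contribution_arith[OF k, of s] by simp
  thus ?thesis by simp
qed

lemma tensor_trace_signed_laplacian:
  assumes k: "k \<ge> 2" and E: "uniform_hypergraph k {1..n} E" and d: "d \<in> {1..k}"
  shows "tensor_trace k n d (signed_laplacian_tensor s k E) =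
    (if d = k then s ^ k * real k ^ (k - 1) * (real k - 1) powi (int n - int k) * real (card E) else 0) +
    (real k - 1) ^ (n - 1) * (\<Sum>i=1..n. real (vertex_degree E i) ^ d)"
proof -
  \<comment> \<open>The exponent \<open>int n - int k\<close> is negative only if there is no edge,
    and then both sides vanish. An edge forces \<open>k\<close> to be at most \<open>n\<close>, so
    natural exponents suffice.\<close>
  have powi: "(real k - 1) ^ (n - 1) * (b / (real k - 1) ^ (k - 1) * real (card E)) =
      b * (real k - 1) powi (int n - int k) * real (card E)" for b :: real
  proof (cases "E = {}")
    case False
    then obtain e where "e \<subseteq> {1..n}" "card e = k" using E by (auto simp: uniform_hypergraph_def)
    hence nk: "n \<ge> k" using card_mono[of "{1..n}" e] by simp
    have "(real k - 1) ^ (n - 1) = (real k - 1) ^ (n - k) * (real k - 1) ^ (k - 1)"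
      using nk k by (simp flip: power_add)
    moreover have "(real k - 1) powi (int n - int k) = (real k - 1) ^ (n - k)"
      using nk by (simp add: power_int_def nat_diff_distrib)
    ultimately show ?thesis using k by simp
  qed simp
  have "real (k - 1) = real k - 1" using k by simp
  thus ?thesis
    unfolding tensor_trace_eq_sum_summands sum_trace_summands[OF k E d] sum_edge_summands[OF k E]
    using powi[of "s ^ k * real k ^ (k - 1)"] by (simp add: distrib_left)
qed

theorem theorem2p3:
  fixes k n :: nat and E :: "nat set set"
  assumes "k \<ge> 2"
    and "uniform_hypergraph k {1..n} E"
  shows "(\<forall>t\<in>{1..k - 1}.
            tensor_trace k n t (laplacian_tensor k E) =
              tensor_trace k n t (signless_laplacian_tensor k E) \<and>
            tensor_trace k n t (signless_laplacian_tensor k E) =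
              (real k - 1) ^ (n - 1) * (\<Sum>i=1..n. real (vertex_degree E i) ^ t)) \<and>
         tensor_trace k n k (laplacian_tensor k E) =
           (- 1) ^ k * real k ^ (k - 1) * (real k - 1) powi (int n - int k) * real (card E) +
           (real k - 1) ^ (n - 1) * (\<Sum>i=1..n. real (vertex_degree E i) ^ k) \<and>
         tensor_trace k n k (signless_laplacian_tensor k E) =
           real k ^ (k - 1) * (real k - 1) powi (int n - int k) * real (card E) +
           (real k - 1) ^ (n - 1) * (\<Sum>i=1..n. real (vertex_degree E i) ^ k)"
proof -
  note trace = tensor_trace_signed_laplacian[OF assms]
  \<comment> \<open>Below degree \<open>k\<close> the edge term is absent, so the trace does not
    depend on \<open>s\<close>.\<close>
  have "tensor_trace k n t (signed_laplacian_tensor s k E) =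
      (real k - 1) ^ (n - 1) * (\<Sum>i=1..n. real (vertex_degree E i) ^ t)" if "t \<in> {1..k - 1}" for s t
    using trace[of t s] that assms(1) by auto
  moreover have "k \<in> {1..k}" using assms(1) by simp
  ultimately show ?thesis
    unfolding laplacian_tensor_eq_signed signless_laplacian_tensor_eq_signed
    using trace[of k "-1"] trace[of k 1] by simp
qed

end
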